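(* Let $\mathcal{E}$ be a topos satisfying NS, WDQO and DSO (equivalently, a topos satisfying NS that is precohesive over a Boolean base). If $\mathcal{E}$ is not a quality type, then it is sufficiently cohesive.
   Context: A point of $X$ is an arrow $1\to X$. An object of a topos is decidable if its diagonal is a complemented subobject; $\mathcal{I}:\mathrm{Dec}(\mathcal{E})\to\mathcal{E}$ is the inclusion of the full subcategory of decidable objects. NS: every non-initial object has a point. WDQO: for every object $X$ there is a minimal decidable object, $p_X:X\to\Pi(X)$ with $\Pi(X)$ decidable, such that every arrow $X\to1+1$ factors uniquely through $p_X$. DSO: for every object $X$ there is a unique decidable subobject $\gamma_X:\Gamma X\rightarrowtail X$ containing all the points of $X$. It is known that for a topos satisfying NS, being precohesive over a Boolean base is equivalent to satisfying WDQO and DSO, and that in that case the precohesion is realized by a string of adjoints $\Pi\dashv\mathcal{I}\dashv\Gamma\dashv\Lambda$ between $\mathcal{E}$ and $\mathrm{Dec}(\mathcal{E})$, where $p$ is the unit of $\Pi\dashv\mathcal{I}$, $\gamma$ is the counit of $\mathcal{I}\dashv\Gamma$, and $\Pi$ preserves finite products. $\mathcal{E}$ is a quality type if the natural transformation $\theta:\Gamma\Rightarrow\Pi$, $\theta_X=p_X\circ\gamma_X$, is an isomorphism. An object $A$ is connected if $\Pi(A)=1$. $A$ is Lawvere contractible if $A^X$ is connected for every $X\in\mathcal{E}$; $\mathcal{E}$ is sufficiently cohesive if every object is a subobject of a Lawvere contractible object. *)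

theory Defs
  imports Main
begin

section \<open>Categories\<close>

record ('o, 'm) cat =
  Ob :: "'o set"
  Mor :: "'m set"
  Dom :: "'m \<Rightarrow> 'o"
  Cod :: "'m \<Rightarrow> 'o"
  Id :: "'o \<Rightarrow> 'm"
  Comp :: "'m \<Rightarrow> 'm \<Rightarrow> 'm" (infixr \<open>\<cdot>\<index>\<close> 70)

definition hom :: "('o, 'm, 'e) cat_scheme \<Rightarrow> 'o \<Rightarrow> 'o \<Rightarrow> 'm set" where
  "hom C X Y = {f \<in> Mor C. Dom C f = X \<and> Cod C f = Y}"

locale category =
  fixes C :: "('o, 'm, 'e) cat_scheme" (structure)
  assumes Dom_Ob: "f \<in> Mor C \<Longrightarrow> Dom C f \<in> Ob C"
    and Cod_Ob: "f \<in> Mor C \<Longrightarrow> Cod C f \<in> Ob C"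
    and Id_hom: "X \<in> Ob C \<Longrightarrow> Id C X \<in> hom C X X"
    and Comp_hom: "\<lbrakk>f \<in> hom C X Y; g \<in> hom C Y Z\<rbrakk> \<Longrightarrow> g \<cdot> f \<in> hom C X Z"
    and Id_right: "f \<in> hom C X Y \<Longrightarrow> f \<cdot> Id C X = f"
    and Id_left: "f \<in> hom C X Y \<Longrightarrow> Id C Y \<cdot> f = f"
    and Comp_assoc: "\<lbrakk>f \<in> hom C W X; g \<in> hom C X Y; h \<in> hom C Y Z\<rbrakk>
      \<Longrightarrow> (h \<cdot> g) \<cdot> f = h \<cdot> (g \<cdot> f)"

definition monic :: "('o, 'm, 'e) cat_scheme \<Rightarrow> 'm \<Rightarrow> bool" where
  "monic C m \<longleftrightarrow> m \<in> Mor C \<and>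
    (\<forall>Z \<in> Ob C. \<forall>f \<in> hom C Z (Dom C m). \<forall>g \<in> hom C Z (Dom C m).
      m \<cdot>\<^bsub>C\<^esub> f = m \<cdot>\<^bsub>C\<^esub> g \<longrightarrow> f = g)"

definition isomorphism :: "('o, 'm, 'e) cat_scheme \<Rightarrow> 'm \<Rightarrow> bool" where
  "isomorphism C f \<longleftrightarrow> f \<in> Mor C \<and>
    (\<exists>g \<in> hom C (Cod C f) (Dom C f).
      g \<cdot>\<^bsub>C\<^esub> f = Id C (Dom C f) \<and> f \<cdot>\<^bsub>C\<^esub> g = Id C (Cod C f))"


section \<open>Universal constructions\<close>

text \<open>
  Each universal construction is a predicate on the candidate object together with its structure
  maps. No choice of terminal object, products, etc. is fixed; a notion that refers to one of them
  quantifies over all candidates.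
\<close>

definition terminal :: "('o, 'm, 'e) cat_scheme \<Rightarrow> 'o \<Rightarrow> bool" where
  "terminal C T \<longleftrightarrow> T \<in> Ob C \<and> (\<forall>X \<in> Ob C. \<exists>!f. f \<in> hom C X T)"

definition initial :: "('o, 'm, 'e) cat_scheme \<Rightarrow> 'o \<Rightarrow> bool" where
  "initial C I \<longleftrightarrow> I \<in> Ob C \<and> (\<forall>X \<in> Ob C. \<exists>!f. f \<in> hom C I X)"

definition product ::
  "('o, 'm, 'e) cat_scheme \<Rightarrow> 'o \<Rightarrow> 'o \<Rightarrow> 'o \<Rightarrow> 'm \<Rightarrow> 'm \<Rightarrow> bool" where
  "product C X Y P p q \<longleftrightarrow> p \<in> hom C P X \<and> q \<in> hom C P Y \<and>
    (\<forall>Z \<in> Ob C. \<forall>f \<in> hom C Z X. \<forall>g \<in> hom C Z Y.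
      \<exists>!h. h \<in> hom C Z P \<and> p \<cdot>\<^bsub>C\<^esub> h = f \<and> q \<cdot>\<^bsub>C\<^esub> h = g)"

definition coproduct ::
  "('o, 'm, 'e) cat_scheme \<Rightarrow> 'o \<Rightarrow> 'o \<Rightarrow> 'o \<Rightarrow> 'm \<Rightarrow> 'm \<Rightarrow> bool" where
  "coproduct C X Y S i j \<longleftrightarrow> i \<in> hom C X S \<and> j \<in> hom C Y S \<and>
    (\<forall>Z \<in> Ob C. \<forall>f \<in> hom C X Z. \<forall>g \<in> hom C Y Z.
      \<exists>!h. h \<in> hom C S Z \<and> h \<cdot>\<^bsub>C\<^esub> i = f \<and> h \<cdot>\<^bsub>C\<^esub> j = g)"

text \<open>In \<open>pullback C f g P p q\<close> the commutative square is \<open>f \<cdot> p = g \<cdot> q\<close>.\<close>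

definition pullback ::
  "('o, 'm, 'e) cat_scheme \<Rightarrow> 'm \<Rightarrow> 'm \<Rightarrow> 'o \<Rightarrow> 'm \<Rightarrow> 'm \<Rightarrow> bool" where
  "pullback C f g P p q \<longleftrightarrow>
    f \<in> Mor C \<and> g \<in> Mor C \<and> Cod C f = Cod C g \<and>
    p \<in> hom C P (Dom C f) \<and> q \<in> hom C P (Dom C g) \<and> f \<cdot>\<^bsub>C\<^esub> p = g \<cdot>\<^bsub>C\<^esub> q \<and>
    (\<forall>Z \<in> Ob C. \<forall>a \<in> hom C Z (Dom C f). \<forall>b \<in> hom C Z (Dom C g).
      f \<cdot>\<^bsub>C\<^esub> a = g \<cdot>\<^bsub>C\<^esub> b \<longrightarrow>
      (\<exists>!h. h \<in> hom C Z P \<and> p \<cdot>\<^bsub>C\<^esub> h = a \<and> q \<cdot>\<^bsub>C\<^esub> h = b))"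

text \<open>
  \<open>exponential C A X E P p q e\<close>: the object \<open>E\<close> is an exponential \<open>A\<^sup>X\<close>, with evaluation
  \<open>e\<close> defined on the product \<open>P\<close> of \<open>E\<close> and \<open>X\<close>. The morphism \<open>k\<close> below is \<open>h \<times> X\<close>.
\<close>

definition exponential ::
  "('o, 'm, 'e) cat_scheme \<Rightarrow> 'o \<Rightarrow> 'o \<Rightarrow> 'o \<Rightarrow> 'o \<Rightarrow> 'm \<Rightarrow> 'm \<Rightarrow> 'm \<Rightarrow> bool" where
  "exponential C A X E P p q e \<longleftrightarrow> product C E X P p q \<and> e \<in> hom C P A \<and>
    (\<forall>Z Q r s f. product C Z X Q r s \<and> f \<in> hom C Q A \<longrightarrow>
      (\<exists>!h. h \<in> hom C Z E \<and>
        (\<exists>k \<in> hom C Q P. p \<cdot>\<^bsub>C\<^esub> k = h \<cdot>\<^bsub>C\<^esub> r \<and> q \<cdot>\<^bsub>C\<^esub> k = s \<and> e \<cdot>\<^bsub>C\<^esub> k = f)))"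

definition subobject_classifier :: "('o, 'm, 'e) cat_scheme \<Rightarrow> 'o \<Rightarrow> 'm \<Rightarrow> bool" where
  "subobject_classifier C \<Omega> t \<longleftrightarrow> t \<in> Mor C \<and> terminal C (Dom C t) \<and> Cod C t = \<Omega> \<and>
    (\<forall>m. monic C m \<longrightarrow>
      (\<exists>!\<chi>. \<chi> \<in> hom C (Cod C m) \<Omega> \<and> (\<exists>u. pullback C \<chi> t (Dom C m) m u)))"

text \<open>
  Finite limits are given by a terminal object and pullbacks. Finite colimits are not assumed:
  their existence follows from the axioms.
\<close>

locale topos = category C for C :: "('o, 'm, 'e) cat_scheme" (structure) +
  assumes ex_terminal: "\<exists>T. terminal C T"
    and ex_pullback: "\<lbrakk>f \<in> Mor C; g \<in> Mor C; Cod C f = Cod C g\<rbrakk>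
      \<Longrightarrow> \<exists>P p q. pullback C f g P p q"
    and ex_exponential: "\<lbrakk>A \<in> Ob C; X \<in> Ob C\<rbrakk>
      \<Longrightarrow> \<exists>E P p q e. exponential C A X E P p q e"
    and ex_subobject_classifier: "\<exists>\<Omega> t. subobject_classifier C \<Omega> t"


section \<open>Subobjects, decidable objects and points\<close>

text \<open>
  A subobject is represented by a monomorphism; two of them represent the same subobject
  iff they are related by \<open>sub_le\<close> in both directions.
\<close>

definition subobj :: "('o, 'm, 'e) cat_scheme \<Rightarrow> 'o \<Rightarrow> 'm set" where
  "subobj C X = {m. monic C m \<and> Cod C m = X}"

definition sub_le :: "('o, 'm, 'e) cat_scheme \<Rightarrow> 'm \<Rightarrow> 'm \<Rightarrow> bool" where
  "sub_le C m n \<longleftrightarrow> (\<exists>h \<in> hom C (Dom C m) (Dom C n). n \<cdot>\<^bsub>C\<^esub> h = m)"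

text \<open>
  Complements are those of the poset of subobjects: the meet of \<open>m\<close> and \<open>n\<close> is the least
  subobject and their join is the greatest one.
\<close>

definition complemented :: "('o, 'm, 'e) cat_scheme \<Rightarrow> 'o \<Rightarrow> 'm \<Rightarrow> bool" where
  "complemented C X m \<longleftrightarrow> m \<in> subobj C X \<and> (\<exists>n \<in> subobj C X.
    (\<forall>w \<in> subobj C X. sub_le C w m \<and> sub_le C w n \<longrightarrow> (\<forall>v \<in> subobj C X. sub_le C w v)) \<and>
    (\<forall>w \<in> subobj C X. sub_le C m w \<and> sub_le C n w \<longrightarrow> (\<forall>v \<in> subobj C X. sub_le C v w)))"

definition decidable :: "('o, 'm, 'e) cat_scheme \<Rightarrow> 'o \<Rightarrow> bool" where
  "decidable C X \<longleftrightarrow> X \<in> Ob C \<and>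
    (\<forall>P p q d. product C X X P p q \<and> d \<in> hom C X P \<and>
      p \<cdot>\<^bsub>C\<^esub> d = Id C X \<and> q \<cdot>\<^bsub>C\<^esub> d = Id C X \<longrightarrow> complemented C P d)"

definition points :: "('o, 'm, 'e) cat_scheme \<Rightarrow> 'o \<Rightarrow> 'm set" where
  "points C X = {x. \<exists>T. terminal C T \<and> x \<in> hom C T X}"


section \<open>The three conditions\<close>

definition NS :: "('o, 'm, 'e) cat_scheme \<Rightarrow> bool" where
  "NS C \<longleftrightarrow> (\<forall>X \<in> Ob C. \<not> initial C X \<longrightarrow> points C X \<noteq> {})"

text \<open>In the next definition \<open>S\<close> ranges over the coproducts \<open>1 + 1\<close>.\<close>

definition minimal_decidable :: "('o, 'm, 'e) cat_scheme \<Rightarrow> 'o \<Rightarrow> 'o \<Rightarrow> 'm \<Rightarrow> bool" where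
  "minimal_decidable C X P p \<longleftrightarrow> decidable C P \<and> p \<in> hom C X P \<and>
    (\<forall>T S i j. terminal C T \<and> coproduct C T T S i j \<longrightarrow>
      (\<forall>f \<in> hom C X S. \<exists>!g. g \<in> hom C P S \<and> g \<cdot>\<^bsub>C\<^esub> p = f))"

definition WDQO :: "('o, 'm, 'e) cat_scheme \<Rightarrow> bool" where
  "WDQO C \<longleftrightarrow> (\<forall>X \<in> Ob C. \<exists>P p. minimal_decidable C X P p)"

definition decidable_points_subobj ::
  "('o, 'm, 'e) cat_scheme \<Rightarrow> 'o \<Rightarrow> 'o \<Rightarrow> 'm \<Rightarrow> bool" where
  "decidable_points_subobj C X G g \<longleftrightarrow> g \<in> subobj C X \<and> Dom C g = G \<and> decidable C G \<and>
    (\<forall>x \<in> points C X. \<exists>y \<in> hom C (Dom C x) G. g \<cdot>\<^bsub>C\<^esub> y = x)"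

definition DSO :: "('o, 'm, 'e) cat_scheme \<Rightarrow> bool" where
  "DSO C \<longleftrightarrow> (\<forall>X \<in> Ob C.
    (\<exists>G g. decidable_points_subobj C X G g) \<and>
    (\<forall>G g G' g'. decidable_points_subobj C X G g \<and> decidable_points_subobj C X G' g' \<longrightarrow>
      sub_le C g g' \<and> sub_le C g' g))"


section \<open>Quality types and sufficient cohesion\<close>

text \<open>
  The notions below refer to a choice of the objects \<open>\<Pi>(X)\<close> and \<open>\<Gamma>X\<close> with their structure maps
  \<open>p\<^sub>X\<close> and \<open>\<gamma>\<^sub>X\<close>. A natural transformation is an isomorphism iff all its components are, so only
  the components \<open>p\<^sub>X \<cdot> \<gamma>\<^sub>X\<close> of \<open>\<theta>\<close> occur.
\<close>

definition Pi_choice :: "('o, 'm, 'e) cat_scheme \<Rightarrow> ('o \<Rightarrow> 'o) \<Rightarrow> ('o \<Rightarrow> 'm) \<Rightarrow> bool" where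
  "Pi_choice C \<Pi> p \<longleftrightarrow> (\<forall>X \<in> Ob C. minimal_decidable C X (\<Pi> X) (p X))"

definition Gamma_choice :: "('o, 'm, 'e) cat_scheme \<Rightarrow> ('o \<Rightarrow> 'o) \<Rightarrow> ('o \<Rightarrow> 'm) \<Rightarrow> bool" where
  "Gamma_choice C \<Gamma> \<gamma> \<longleftrightarrow> (\<forall>X \<in> Ob C. decidable_points_subobj C X (\<Gamma> X) (\<gamma> X))"

definition quality_type ::
  "('o, 'm, 'e) cat_scheme \<Rightarrow> ('o \<Rightarrow> 'm) \<Rightarrow> ('o \<Rightarrow> 'm) \<Rightarrow> bool" where
  "quality_type C p \<gamma> \<longleftrightarrow> (\<forall>X \<in> Ob C. isomorphism C (p X \<cdot>\<^bsub>C\<^esub> \<gamma> X))"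

definition connected :: "('o, 'm, 'e) cat_scheme \<Rightarrow> ('o \<Rightarrow> 'o) \<Rightarrow> 'o \<Rightarrow> bool" where
  "connected C \<Pi> A \<longleftrightarrow> A \<in> Ob C \<and> terminal C (\<Pi> A)"

definition Lawvere_contractible ::
  "('o, 'm, 'e) cat_scheme \<Rightarrow> ('o \<Rightarrow> 'o) \<Rightarrow> 'o \<Rightarrow> bool" where
  "Lawvere_contractible C \<Pi> A \<longleftrightarrow> A \<in> Ob C \<and>
    (\<forall>X \<in> Ob C. \<forall>E P p q e. exponential C A X E P p q e \<longrightarrow> connected C \<Pi> E)"

definition sufficiently_cohesive :: "('o, 'm, 'e) cat_scheme \<Rightarrow> ('o \<Rightarrow> 'o) \<Rightarrow> bool" where
  "sufficiently_cohesive C \<Pi> \<longleftrightarrow>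
    (\<forall>X \<in> Ob C. \<exists>A m. Lawvere_contractible C \<Pi> A \<and> m \<in> hom C X A \<and> monic C m)"

end

theory Submission
  imports Defs
begin

text \<open>
  Subobjects are tested on generalized elements: \<open>sub_le C v m\<close> says that \<open>v\<close>, monic or not,
  factors through \<open>m\<close>. Call \<open>A\<close> disjoint-injective if any two maps into \<open>A\<close> defined on
  disjoint subobjects of a common object extend to that object. The classifier \<open>\<Omega>\<close> has this property,
  and \<open>A\<^sup>X\<close> inherits it from \<open>A\<close>. By the uniqueness part of DSO, applied to the decidable object
  \<open>\<Pi>(X)\<close>, the component \<open>\<theta>\<^sub>X\<close> is invertible as soon as \<open>p\<^sub>X\<close> is injective on points. So if
  \<open>\<E>\<close> is not a quality type, some object \<open>B\<close> has two points \<open>x \<noteq> y\<close> with \<open>p x = p y\<close>.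
  These points are disjoint by NS, hence any two points of a disjoint-injective object \<open>E\<close> are the
  images of \<open>x\<close> and \<open>y\<close> under a map \<open>B \<rightarrow> E\<close>, and no map \<open>E \<rightarrow> 1 + 1\<close> separates them. This makes \<open>E\<close>
  connected, so \<open>\<Omega>\<^sup>Y\<close>, which contains \<open>Y\<close> through the singleton map, is Lawvere contractible.

  Finite colimits need not be constructed in general. The name of a counterexample to ``all parallel
  arrows are equal'' yields two distinct points, whose equalizer is initial by NS, and \<open>1 + 1\<close> is cut
  out of \<open>\<Gamma>(\<Omega>)\<close> as the part consisting of two distinct points.
\<close>

section \<open>Generalized elements\<close>

context category
begin

lemma comp_simps [simp]:
  assumes "f \<in> Mor C" "g \<in> Mor C" "Cod C f = Dom C g"
  shows "g \<cdot> f \<in> Mor C" "Dom C (g \<cdot> f) = Dom C f" "Cod C (g \<cdot> f) = Cod C g"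
  using Comp_hom[of f "Dom C f" "Dom C g" g "Cod C g"] assms by (simp_all add: hom_def)

lemma comp_assoc [simp]:
  assumes "f \<in> Mor C" "g \<in> Mor C" "h \<in> Mor C" "Cod C f = Dom C g" "Cod C g = Dom C h"
  shows "(h \<cdot> g) \<cdot> f = h \<cdot> g \<cdot> f"
  using Comp_assoc[of f "Dom C f" "Dom C g" g "Dom C h" h "Cod C h"] assms by (simp add: hom_def)

lemma comp_reassoc:
  assumes "g \<cdot> f = k" "f \<in> Mor C" "g \<in> Mor C" "x \<in> Mor C" "Cod C f = Dom C g" "Cod C x = Dom C f"
  shows "g \<cdot> f \<cdot> x = k \<cdot> x"
  using comp_assoc[of x f g] assms by simp

lemma Id_simps [simp]:
  assumes "X \<in> Ob C"
  shows "Id C X \<in> Mor C" "Dom C (Id C X) = X" "Cod C (Id C X) = X"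
  using Id_hom[OF assms] by (simp_all add: hom_def)

lemma Id_comp [simp]:
  assumes "f \<in> Mor C"
  shows "Cod C f = X \<Longrightarrow> Id C X \<cdot> f = f" "Dom C f = X \<Longrightarrow> f \<cdot> Id C X = f"
  using Id_left[of f "Dom C f"] Id_right[of f _ "Cod C f"] assms by (auto simp: hom_def)

declare Dom_Ob [simp] Cod_Ob [simp]

lemma homE:
  assumes "f \<in> hom C X Y"
  shows "f \<in> Mor C" "Dom C f = X" "Cod C f = Y" "X \<in> Ob C" "Y \<in> Ob C"
  using assms Dom_Ob Cod_Ob by (auto simp: hom_def)

lemma monicD:
  assumes "monic C m" "m \<in> hom C U B" "m \<cdot> f = m \<cdot> g" "f \<in> hom C Z U" "g \<in> hom C Z U"
  shows "f = g"
proof -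
  have "Z \<in> Ob C" using homE[OF assms(4)] by simp
  then show ?thesis using assms unfolding monic_def by (auto simp: hom_def)
qed

lemma monicI:
  assumes "m \<in> hom C U B"
    and "\<And>Z f g. f \<in> hom C Z U \<Longrightarrow> g \<in> hom C Z U \<Longrightarrow> m \<cdot> f = m \<cdot> g \<Longrightarrow> f = g"
  shows "monic C m"
  using assms unfolding monic_def by (auto simp: hom_def)

lemma monic_comp:
  assumes "monic C m" "m \<in> hom C U B" "monic C n" "n \<in> hom C V U"
  shows "monic C (m \<cdot> n)"
proof (rule monicI)
  show "m \<cdot> n \<in> hom C V B" using assms Comp_hom by blast
  fix Z f g assume fg: "f \<in> hom C Z V" "g \<in> hom C Z V" "(m \<cdot> n) \<cdot> f = (m \<cdot> n) \<cdot> g"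
  then have "m \<cdot> n \<cdot> f = m \<cdot> n \<cdot> g" using assms by (simp add: hom_def)
  then have "n \<cdot> f = n \<cdot> g" using monicD[OF assms(1,2)] fg assms(4) Comp_hom by blast
  then show "f = g" using monicD[OF assms(3,4)] fg by blast
qed

lemma split_monic:
  assumes "m \<in> hom C U B" "r \<in> hom C B U" "r \<cdot> m = Id C U"
  shows "monic C m"
proof (rule monicI[OF assms(1)])
  fix Z f g assume fg: "f \<in> hom C Z U" "g \<in> hom C Z U" "m \<cdot> f = m \<cdot> g"
  note [simp] = homE[OF assms(1)] homE[OF assms(2)] homE[OF fg(1)] homE[OF fg(2)]
  have "r \<cdot> m \<cdot> f = r \<cdot> m \<cdot> g" using fg(3) by simp
  then show "f = g" using comp_reassoc[OF assms(3), of f] comp_reassoc[OF assms(3), of g] by simp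
qed

section \<open>Factorization of one arrow through another\<close>

lemma sub_leI:
  assumes "m \<in> hom C U B" "u \<in> hom C V U" "m \<cdot> u = v"
  shows "sub_le C v m"
  using assms unfolding sub_le_def by (auto simp: hom_def)

lemma sub_leE:
  assumes "sub_le C v m" "v \<in> hom C V B" "m \<in> hom C U B"
  obtains u where "u \<in> hom C V U" "m \<cdot> u = v"
  using assms unfolding sub_le_def by (auto simp: hom_def)

lemma sub_le_comp:
  assumes "sub_le C v m" "v \<in> hom C V B" "m \<in> hom C U B" "u \<in> hom C W V"
  shows "sub_le C (v \<cdot> u) m"
proof -
  obtain x where x: "x \<in> hom C V U" "m \<cdot> x = v" using sub_leE[OF assms(1-3)] .
  note [simp] = homE[OF x(1)] homE[OF assms(3)] homE[OF assms(4)]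
  show ?thesis
    by (rule sub_leI[OF assms(3), of "x \<cdot> u" W]) (auto simp: hom_def x(2)[symmetric])
qed

lemma sub_le_trans:
  assumes "sub_le C v m" "sub_le C m n" "v \<in> hom C V B" "m \<in> hom C U B" "n \<in> hom C W B"
  shows "sub_le C v n"
proof -
  obtain x where x: "x \<in> hom C V U" "m \<cdot> x = v" using sub_leE[OF assms(1,3,4)] .
  show ?thesis using sub_le_comp[OF assms(2,4,5) x(1)] x by simp
qed

lemma sub_le_refl: "m \<in> hom C U B \<Longrightarrow> sub_le C m m"
  by (rule sub_leI[of m U B "Id C U"]) (auto simp: hom_def)

lemma sub_le_if_Id:
  assumes "sub_le C (Id C B) w" "w \<in> hom C W B" "v \<in> hom C V B"
  shows "sub_le C v w"
  using sub_le_comp[OF assms(1) Id_hom assms(2,3)] homE[OF assms(3)] by simp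

lemma sub_le_monic_cancel:
  assumes "sub_le C (m \<cdot> v) (m \<cdot> w)" "monic C m" "m \<in> hom C U B" "v \<in> hom C V U" "w \<in> hom C W U"
  shows "sub_le C v w"
proof -
  have "m \<cdot> v \<in> hom C V B" "m \<cdot> w \<in> hom C W B" using assms(3-5) Comp_hom by blast+
  then obtain u where u: "u \<in> hom C V W" "(m \<cdot> w) \<cdot> u = m \<cdot> v" using assms(1) sub_leE by blast
  then have "m \<cdot> w \<cdot> u = m \<cdot> v" using assms(3-5) by (simp add: hom_def)
  then have "w \<cdot> u = v" using monicD[OF assms(2,3)] u assms Comp_hom by blast
  then show ?thesis using sub_leI[OF assms(5) u(1)] by blast
qed

section \<open>Universal properties in usable form\<close>

lemma initial_ex: "initial C Z \<Longrightarrow> Y \<in> Ob C \<Longrightarrow> \<exists>f. f \<in> hom C Z Y"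
  unfolding initial_def by blast

lemma initial_eq: "initial C Z \<Longrightarrow> f \<in> hom C Z Y \<Longrightarrow> g \<in> hom C Z Y \<Longrightarrow> f = g"
  unfolding initial_def by (metis homE(5))

lemma initial_sub_le:
  assumes "initial C V" "v \<in> hom C V B" "m \<in> hom C U B"
  shows "sub_le C v m"
proof -
  obtain u where u: "u \<in> hom C V U" using initial_ex[OF assms(1) homE(4)[OF assms(3)]] by blast
  show ?thesis using sub_leI[OF assms(3) u] initial_eq[OF assms(1) Comp_hom[OF u assms(3)] assms(2)]
    by simp
qed

lemma terminal_ex: "terminal C T \<Longrightarrow> X \<in> Ob C \<Longrightarrow> \<exists>f. f \<in> hom C X T"
  unfolding terminal_def by blast

lemma terminal_eq: "terminal C T \<Longrightarrow> f \<in> hom C X T \<Longrightarrow> g \<in> hom C X T \<Longrightarrow> f = g"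
  unfolding terminal_def by (metis homE(4))

lemma product_pair:
  assumes "product C X Y P p q" "f \<in> hom C Z X" "g \<in> hom C Z Y"
  obtains h where "h \<in> hom C Z P" "p \<cdot> h = f" "q \<cdot> h = g"
  using assms homE(4)[OF assms(2)] unfolding product_def by metis

lemma productD:
  assumes "product C X Y P p q"
  shows "p \<in> hom C P X" "q \<in> hom C P Y"
  using assms unfolding product_def by blast+

lemma product_eqI:
  assumes P: "product C X Y P p q" and h: "h \<in> hom C Z P" "h' \<in> hom C Z P"
    and eq: "p \<cdot> h = p \<cdot> h'" "q \<cdot> h = q \<cdot> h'"
  shows "h = h'"
proof -
  have "p \<cdot> h' \<in> hom C Z X" "q \<cdot> h' \<in> hom C Z Y" "Z \<in> Ob C"
    using Comp_hom[OF h(2)] productD[OF P] homE(4)[OF h(1)] by auto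
  then have "\<exists>!k. k \<in> hom C Z P \<and> p \<cdot> k = p \<cdot> h' \<and> q \<cdot> k = q \<cdot> h'"
    using P unfolding product_def by blast
  then show ?thesis using h eq by blast
qed

text \<open>Turns equality of arrows into membership in a subobject, for use with equalizers, the
  singleton map and decidability. The factor through \<open>d\<close> is
  \<open>p \<cdot> v\<close>.\<close>

lemma diagonal_le_iff:
  assumes P: "product C X X P p q" and d: "d \<in> hom C X P" "p \<cdot> d = Id C X" "q \<cdot> d = Id C X"
    and v: "v \<in> hom C V P"
  shows "sub_le C v d \<longleftrightarrow> p \<cdot> v = q \<cdot> v"
proof
  note [simp] = homE[OF d(1)] homE[OF v] homE[OF productD(1)[OF P]] homE[OF productD(2)[OF P]]
  assume "sub_le C v d"
  then obtain u where u: "u \<in> hom C V X" "d \<cdot> u = v" using sub_leE[OF _ v d(1)] by blast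
  note [simp] = homE[OF u(1)]
  show "p \<cdot> v = q \<cdot> v"
    using comp_reassoc[OF d(2), of u] comp_reassoc[OF d(3), of u] u(2) by simp
next
  note [simp] = homE[OF d(1)] homE[OF v] homE[OF productD(1)[OF P]] homE[OF productD(2)[OF P]]
  assume eq: "p \<cdot> v = q \<cdot> v"
  have "d \<cdot> p \<cdot> v = v"
    by (rule product_eqI[OF P _ v])
      (use eq comp_reassoc[OF d(2), of "p \<cdot> v"] comp_reassoc[OF d(3), of "p \<cdot> v"] in \<open>auto simp: hom_def\<close>)
  then show "sub_le C v d" using sub_leI[OF d(1), of "p \<cdot> v" V v] by (simp add: hom_def)
qed

lemma exponentialD:
  assumes "exponential C A X E P p q e"
  shows "product C E X P p q" "e \<in> hom C P A"
  using assms unfolding exponential_def by blast+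

lemma transpose_ex:
  assumes "exponential C A X E P p q e" "product C Z X Q r s" "f \<in> hom C Q A"
  obtains h k where "h \<in> hom C Z E" "k \<in> hom C Q P" "p \<cdot> k = h \<cdot> r" "q \<cdot> k = s" "e \<cdot> k = f"
  using assms unfolding exponential_def by blast

text \<open>\<open>k\<close> and \<open>k'\<close> stand for \<open>h \<times> X\<close> and
  \<open>h' \<times> X\<close>, so \<open>h\<close> and \<open>h'\<close> both transpose the single
  arrow \<open>e \<cdot> k\<close>.\<close>

lemma transpose_eqI:
  assumes E: "exponential C A X E P p q e" and Q: "product C Z X Q r s"
    and h: "h \<in> hom C Z E" "k \<in> hom C Q P" "p \<cdot> k = h \<cdot> r" "q \<cdot> k = s"
    and h': "h' \<in> hom C Z E" "k' \<in> hom C Q P" "p \<cdot> k' = h' \<cdot> r" "q \<cdot> k' = s"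
    and eq: "e \<cdot> k = e \<cdot> k'"
  shows "h = h'"
proof -
  have "e \<cdot> k \<in> hom C Q A" using exponentialD(2)[OF E] h Comp_hom by blast
  then have "\<exists>!h. h \<in> hom C Z E \<and>
        (\<exists>l \<in> hom C Q P. p \<cdot> l = h \<cdot> r \<and> q \<cdot> l = s \<and> e \<cdot> l = e \<cdot> k)"
    using E Q unfolding exponential_def by blast
  moreover have "\<exists>l \<in> hom C Q P. p \<cdot> l = h \<cdot> r \<and> q \<cdot> l = s \<and> e \<cdot> l = e \<cdot> k"
    using h by blast
  moreover have "\<exists>l \<in> hom C Q P. p \<cdot> l = h' \<cdot> r \<and> q \<cdot> l = s \<and> e \<cdot> l = e \<cdot> k"
    using h' eq by metis
  ultimately show ?thesis using h(1) h'(1) by blast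
qed

end

section \<open>Predicates in a topos\<close>

context topos
begin

section \<open>The chosen classifier and terminal object\<close>

definition true_arrow :: 'm where
  "true_arrow = (SOME t. \<exists>\<Omega>. subobject_classifier C \<Omega> t)"

text \<open>Taking the domain of \<open>true_arrow\<close> as the terminal object makes
  \<open>true_arrow\<close> itself a point of \<open>omega\<close>.\<close>

definition one :: 'o where "one = Dom C true_arrow"

definition omega :: 'o where "omega = Cod C true_arrow"

definition bang :: "'o \<Rightarrow> 'm" where "bang X = (THE f. f \<in> hom C X one)"

text \<open>The constantly true predicate. A predicate holds at a generalized element
  \<open>v\<close> with domain \<open>V\<close> when its composite with \<open>v\<close> is
  \<open>tr V\<close>.\<close>

definition tr :: "'o \<Rightarrow> 'm" where "tr X = true_arrow \<cdot> bang X"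

lemma classifier: "subobject_classifier C omega true_arrow"
proof -
  have "\<exists>t \<Omega>. subobject_classifier C \<Omega> t" using ex_subobject_classifier by blast
  then have "\<exists>\<Omega>. subobject_classifier C \<Omega> true_arrow"
    unfolding true_arrow_def by (rule someI_ex)
  then show ?thesis unfolding omega_def subobject_classifier_def by blast
qed

lemma terminal_one: "terminal C one"
  using classifier unfolding subobject_classifier_def one_def by blast

lemma true_hom: "true_arrow \<in> hom C one omega"
  using classifier unfolding subobject_classifier_def one_def hom_def by blast

lemma one_Ob [simp]: "one \<in> Ob C" and omega_Ob [simp]: "omega \<in> Ob C"
  using homE[OF true_hom] by auto

lemma bang_hom: "X \<in> Ob C \<Longrightarrow> bang X \<in> hom C X one"
  using terminal_one unfolding terminal_def bang_def by (metis theI')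

lemma bang_eq: "f \<in> hom C X one \<Longrightarrow> f = bang X"
  using terminal_eq[OF terminal_one] bang_hom homE(4) by blast

lemma bang_one [simp]: "bang one = Id C one"
  using bang_eq[OF Id_hom[OF one_Ob]] by simp

lemma bang_simps [simp]:
  assumes "X \<in> Ob C"
  shows "bang X \<in> Mor C" "Dom C (bang X) = X" "Cod C (bang X) = one"
  using homE[OF bang_hom[OF assms]] by auto

lemma bang_comp [simp]: "f \<in> Mor C \<Longrightarrow> Cod C f = Y \<Longrightarrow> bang Y \<cdot> f = bang (Dom C f)"
  by (rule bang_eq) (auto simp: hom_def)

lemma tr_hom: "X \<in> Ob C \<Longrightarrow> tr X \<in> hom C X omega"
  unfolding tr_def using bang_hom true_hom Comp_hom by blast

lemma tr_comp: "f \<in> hom C X Y \<Longrightarrow> tr Y \<cdot> f = tr X"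
  unfolding tr_def using homE[of f X Y] homE[OF true_hom] by simp

lemma point_monic:
  assumes "x \<in> hom C one X"
  shows "monic C x"
  by (rule split_monic[OF assms bang_hom]) (use homE[OF assms] in auto)

lemma sub_le_point_iff:
  assumes "x \<in> hom C one X" "v \<in> hom C V X"
  shows "sub_le C v x \<longleftrightarrow> v = x \<cdot> bang V"
proof
  assume "sub_le C v x"
  then show "v = x \<cdot> bang V" using sub_leE[OF _ assms(2,1)] bang_eq by metis
next
  assume "v = x \<cdot> bang V"
  then show "sub_le C v x" using sub_leI[OF assms(1) bang_hom, of V v] homE[OF assms(2)] by simp
qed

section \<open>Finite limits and the subobjects they yield\<close>

lemma product_exists:
  assumes "X \<in> Ob C" "Y \<in> Ob C"
  obtains P p q where "product C X Y P p q"
proof -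
  obtain P p q where P: "pullback C (bang X) (bang Y) P p q"
    using ex_pullback[of "bang X" "bang Y"] assms by auto
  have "product C X Y P p q"
    unfolding product_def
  proof (intro conjI ballI)
    show "p \<in> hom C P X" "q \<in> hom C P Y" using P assms unfolding pullback_def by auto
    fix Z f g assume a: "Z \<in> Ob C" "f \<in> hom C Z X" "g \<in> hom C Z Y"
    then have "bang X \<cdot> f = bang Y \<cdot> g" using homE[of f] homE[of g] by simp
    then show "\<exists>!h. h \<in> hom C Z P \<and> p \<cdot> h = f \<and> q \<cdot> h = g"
      using P a assms unfolding pullback_def by auto
  qed
  then show thesis using that by blast
qed

text \<open>The pullback of \<open>m\<close> along \<open>f\<close>, exported only through its
  generalized elements. Arrows identified by \<open>k\<close> are identified by \<open>l\<close>
  too, since \<open>m\<close> is monic, so uniqueness in the pullback makes \<open>k\<close>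
  monic.\<close>

lemma inverse_image:
  assumes f: "f \<in> hom C A B" and m: "monic C m" "m \<in> hom C U B"
  obtains k K where "k \<in> hom C K A" "monic C k"
    "\<And>V v. v \<in> hom C V A \<Longrightarrow> sub_le C v k \<longleftrightarrow> sub_le C (f \<cdot> v) m"
proof -
  note [simp] = homE[OF f] homE[OF m(2)]
  obtain K k l where P: "pullback C f m K k l" using ex_pullback[of f m] by auto
  then have k: "k \<in> hom C K A" and l: "l \<in> hom C K U" and eq: "f \<cdot> k = m \<cdot> l"
    and univ: "\<And>Z a b. Z \<in> Ob C \<Longrightarrow> a \<in> hom C Z A \<Longrightarrow> b \<in> hom C Z U \<Longrightarrow> f \<cdot> a = m \<cdot> b \<Longrightarrow>
      \<exists>!h. h \<in> hom C Z K \<and> k \<cdot> h = a \<and> l \<cdot> h = b"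
    unfolding pullback_def by auto
  note [simp] = homE[OF k] homE[OF l]
  have mon: "monic C k"
  proof (rule monicI[OF k])
    fix Z g h assume gh: "g \<in> hom C Z K" "h \<in> hom C Z K" "k \<cdot> g = k \<cdot> h"
    note [simp] = homE[OF gh(1)] homE[OF gh(2)]
    have "m \<cdot> l \<cdot> g = m \<cdot> l \<cdot> h"
      using comp_reassoc[OF eq, of g] comp_reassoc[OF eq, of h] gh(3) by simp
    then have lg: "l \<cdot> g = l \<cdot> h" using monicD[OF m] gh l Comp_hom by blast
    have "\<exists>!x. x \<in> hom C Z K \<and> k \<cdot> x = k \<cdot> h \<and> l \<cdot> x = l \<cdot> h"
      by (rule univ) (use comp_reassoc[OF eq, of h] in \<open>auto simp: hom_def\<close>)
    then show "g = h" using gh lg by blast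
  qed
  show thesis
  proof (rule that[OF k mon])
    fix V v assume v: "v \<in> hom C V A"
    note [simp] = homE[OF v]
    show "sub_le C v k \<longleftrightarrow> sub_le C (f \<cdot> v) m"
    proof
      assume "sub_le C v k"
      then obtain u where u: "u \<in> hom C V K" "k \<cdot> u = v" using sub_leE[OF _ v k] by blast
      note [simp] = homE[OF u(1)]
      show "sub_le C (f \<cdot> v) m"
        by (rule sub_leI[OF m(2), of "l \<cdot> u" V])
          (use comp_reassoc[OF eq, of u] u in \<open>auto simp: hom_def\<close>)
    next
      assume "sub_le C (f \<cdot> v) m"
      then obtain u where u: "u \<in> hom C V U" "m \<cdot> u = f \<cdot> v"
        using sub_leE[OF _ Comp_hom[OF v f] m(2)] by blast
      then obtain h where "h \<in> hom C V K" "k \<cdot> h = v" using univ[OF _ v u(1)] by auto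
      then show "sub_le C v k" using sub_leI[OF k] by blast
    qed
  qed
qed

lemma intersection:
  assumes "monic C m" "m \<in> hom C U B" "monic C n" "n \<in> hom C V B"
  obtains k K where "k \<in> hom C K B" "monic C k"
    "\<And>W w. w \<in> hom C W B \<Longrightarrow> sub_le C w k \<longleftrightarrow> sub_le C w m \<and> sub_le C w n"
proof -
  obtain k K where k: "k \<in> hom C K U" "monic C k"
    "\<And>W w. w \<in> hom C W U \<Longrightarrow> sub_le C w k \<longleftrightarrow> sub_le C (m \<cdot> w) n"
    by (rule inverse_image[OF assms(2,3,4)]) (rule that; blast)
  have mk: "m \<cdot> k \<in> hom C K B" using Comp_hom[OF k(1) assms(2)] .
  show thesis
  proof (rule that[OF mk monic_comp[OF assms(1,2) k(2,1)]])
    fix W w assume w: "w \<in> hom C W B"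
    show "sub_le C w (m \<cdot> k) \<longleftrightarrow> sub_le C w m \<and> sub_le C w n"
    proof
      assume le: "sub_le C w (m \<cdot> k)"
      have "sub_le C (m \<cdot> k) m" using sub_leI[OF assms(2) k(1)] by blast
      moreover have "sub_le C (m \<cdot> k) n" using k(3)[OF k(1)] sub_le_refl[OF k(1)] by blast
      ultimately show "sub_le C w m \<and> sub_le C w n"
        using sub_le_trans[OF le _ w mk] assms(2,4) by blast
    next
      assume le: "sub_le C w m \<and> sub_le C w n"
      then obtain u where u: "u \<in> hom C W U" "m \<cdot> u = w" using sub_leE[OF _ w assms(2)] by blast
      then have "sub_le C u k" using k(3) le by simp
      then obtain x where x: "x \<in> hom C W K" "k \<cdot> x = u" using sub_leE[OF _ u(1) k(1)] by blast
      then have "(m \<cdot> k) \<cdot> x = w" using u homE[OF x(1)] homE[OF k(1)] homE[OF assms(2)] by simp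
      then show "sub_le C w (m \<cdot> k)" using sub_leI[OF mk x(1)] by blast
    qed
  qed
qed

text \<open>The inverse image of the diagonal of \<open>Y\<close> along the pair \<open>h\<close> of
  \<open>f\<close> and \<open>g\<close>.\<close>

lemma equalizer:
  assumes f: "f \<in> hom C X Y" and g: "g \<in> hom C X Y"
  obtains e E where "e \<in> hom C E X" "monic C e"
    "\<And>V v. v \<in> hom C V X \<Longrightarrow> sub_le C v e \<longleftrightarrow> f \<cdot> v = g \<cdot> v"
proof -
  note [simp] = homE[OF f] homE[OF g]
  obtain P p q where P: "product C Y Y P p q" using product_exists[of Y Y] by auto
  note [simp] = homE[OF productD(1)[OF P]] homE[OF productD(2)[OF P]]
  obtain d where d: "d \<in> hom C Y P" "p \<cdot> d = Id C Y" "q \<cdot> d = Id C Y"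
    using product_pair[OF P Id_hom Id_hom] by auto
  obtain h where h: "h \<in> hom C X P" "p \<cdot> h = f" "q \<cdot> h = g" using product_pair[OF P f g] .
  note [simp] = homE[OF d(1)] homE[OF h(1)]
  have mon_d: "monic C d" by (rule split_monic[OF d(1) productD(1)[OF P] d(2)])
  obtain e E where e: "e \<in> hom C E X" "monic C e"
    "\<And>V v. v \<in> hom C V X \<Longrightarrow> sub_le C v e \<longleftrightarrow> sub_le C (h \<cdot> v) d"
    by (rule inverse_image[OF h(1) mon_d d(1)]) (rule that; blast)
  show thesis
  proof (rule that[OF e(1,2)])
    fix V v assume v: "v \<in> hom C V X"
    note [simp] = homE[OF v]
    show "sub_le C v e \<longleftrightarrow> f \<cdot> v = g \<cdot> v"
      using e(3)[OF v] diagonal_le_iff[OF P d Comp_hom[OF v h(1)]]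
        comp_reassoc[OF h(2), of v] comp_reassoc[OF h(3), of v] by simp
  qed
qed

section \<open>Subobjects and their classifying arrows\<close>

lemma pullback_true_iff:
  assumes "\<chi> \<in> hom C B omega" "monic C m" "m \<in> hom C U B"
  shows "(\<exists>u. pullback C \<chi> true_arrow U m u) \<longleftrightarrow>
    (\<forall>V v. v \<in> hom C V B \<longrightarrow> (\<chi> \<cdot> v = tr V \<longleftrightarrow> sub_le C v m))" (is "?L \<longleftrightarrow> ?R")
proof
  note [simp] = homE[OF assms(1)] homE[OF assms(3)] homE[OF true_hom]
  assume ?L
  then obtain u where u: "pullback C \<chi> true_arrow U m u" by blast
  then have u1: "u = bang U" and eq: "\<chi> \<cdot> m = true_arrow \<cdot> u"
    and univ: "\<And>Z a b. Z \<in> Ob C \<Longrightarrow> a \<in> hom C Z B \<Longrightarrow> b \<in> hom C Z one \<Longrightarrow> \<chi> \<cdot> a = true_arrow \<cdot> b \<Longrightarrow>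
      \<exists>!h. h \<in> hom C Z U \<and> m \<cdot> h = a \<and> u \<cdot> h = b"
    unfolding pullback_def using bang_eq by auto
  show ?R
  proof (intro allI impI)
    fix V v assume v: "v \<in> hom C V B"
    note [simp] = homE[OF v]
    show "\<chi> \<cdot> v = tr V \<longleftrightarrow> sub_le C v m"
    proof
      assume "\<chi> \<cdot> v = tr V"
      then obtain h where "h \<in> hom C V U" "m \<cdot> h = v"
        using univ[OF _ v bang_hom] unfolding tr_def by auto
      then show "sub_le C v m" using sub_leI[OF assms(3)] by blast
    next
      assume "sub_le C v m"
      then obtain x where x: "x \<in> hom C V U" "m \<cdot> x = v" using sub_leE[OF _ v assms(3)] by blast
      note [simp] = homE[OF x(1)]
      show "\<chi> \<cdot> v = tr V" using comp_reassoc[OF eq, of x] x(2) unfolding tr_def u1 by simp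
    qed
  qed
next
  note [simp] = homE[OF assms(1)] homE[OF assms(3)] homE[OF true_hom]
  assume R: ?R
  have "pullback C \<chi> true_arrow U m (bang U)"
    unfolding pullback_def
  proof (intro conjI ballI impI)
    show "\<chi> \<cdot> m = true_arrow \<cdot> bang U"
      using R assms(3) sub_le_refl[OF assms(3)] unfolding tr_def by blast
    fix Z a b assume a: "Z \<in> Ob C" "a \<in> hom C Z (Dom C \<chi>)" "b \<in> hom C Z (Dom C true_arrow)"
      "\<chi> \<cdot> a = true_arrow \<cdot> b"
    then have b: "b = bang Z" and a': "a \<in> hom C Z B" using bang_eq by auto
    then have "sub_le C a m" using R a(4) unfolding tr_def by blast
    then obtain h where h: "h \<in> hom C Z U" "m \<cdot> h = a" using sub_leE[OF _ a' assms(3)] by blast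
    show "\<exists>!h. h \<in> hom C Z U \<and> m \<cdot> h = a \<and> bang U \<cdot> h = b"
    proof (rule ex1I[of _ h])
      show "h \<in> hom C Z U \<and> m \<cdot> h = a \<and> bang U \<cdot> h = b" using h homE[OF h(1)] b by simp
      fix k assume "k \<in> hom C Z U \<and> m \<cdot> k = a \<and> bang U \<cdot> k = b"
      then show "k = h" using monicD[OF assms(2,3)] h by metis
    qed
  qed (auto simp: hom_def)
  then show ?L by blast
qed

lemma classify:
  assumes "monic C m" "m \<in> hom C U B"
  obtains \<chi> where "\<chi> \<in> hom C B omega"
    "\<And>V v. v \<in> hom C V B \<Longrightarrow> \<chi> \<cdot> v = tr V \<longleftrightarrow> sub_le C v m"
proof -
  obtain \<chi> u where \<chi>: "\<chi> \<in> hom C B omega" "pullback C \<chi> true_arrow U m u"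
    using classifier assms homE[OF assms(2)] unfolding subobject_classifier_def by metis
  then show thesis using that[OF \<chi>(1)] pullback_true_iff[OF \<chi>(1) assms] by blast
qed

lemma comprehension:
  assumes \<chi>: "\<chi> \<in> hom C B omega"
  obtains m U where "m \<in> hom C U B" "monic C m"
    "\<And>V v. v \<in> hom C V B \<Longrightarrow> \<chi> \<cdot> v = tr V \<longleftrightarrow> sub_le C v m"
proof -
  obtain m U where m: "m \<in> hom C U B" "monic C m"
    "\<And>V v. v \<in> hom C V B \<Longrightarrow> sub_le C v m \<longleftrightarrow> sub_le C (\<chi> \<cdot> v) true_arrow"
    by (rule inverse_image[OF \<chi> point_monic[OF true_hom] true_hom]) (rule that; blast)
  show thesis
    by (rule that[OF m(1,2)])
      (use m(3) sub_le_point_iff[OF true_hom Comp_hom[OF _ \<chi>]] in \<open>simp add: tr_def\<close>)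
qed

text \<open>Both arrows classify the subobject \<open>m\<close> that comprehension extracts from
  \<open>\<chi>\<close>, and classifying arrows are unique.\<close>

lemma omega_ext:
  assumes "\<chi> \<in> hom C B omega" "\<psi> \<in> hom C B omega"
    and "\<And>V v. v \<in> hom C V B \<Longrightarrow> \<chi> \<cdot> v = tr V \<longleftrightarrow> \<psi> \<cdot> v = tr V"
  shows "\<chi> = \<psi>"
proof -
  obtain m U where m: "m \<in> hom C U B" "monic C m"
    "\<And>V v. v \<in> hom C V B \<Longrightarrow> \<chi> \<cdot> v = tr V \<longleftrightarrow> sub_le C v m"
    by (rule comprehension[OF assms(1)]) (rule that; blast)
  have "\<exists>!\<rho>. \<rho> \<in> hom C B omega \<and> (\<exists>u. pullback C \<rho> true_arrow U m u)"
    using classifier m(1,2) homE[OF m(1)] unfolding subobject_classifier_def by metis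
  moreover have "\<exists>u. pullback C \<chi> true_arrow U m u"
    using pullback_true_iff[OF assms(1) m(2,1)] m(3) by blast
  moreover have "\<exists>u. pullback C \<psi> true_arrow U m u"
    using pullback_true_iff[OF assms(2) m(2,1)] m(3) assms(3) by blast
  ultimately show ?thesis using assms(1,2) by blast
qed

text \<open>The Heyting implication, obtained as the equalizer of the classifiers of
  \<open>m\<close> and of the intersection \<open>l\<close> of \<open>m\<close> and
  \<open>n\<close>. Its membership condition is the forcing clause over all further restrictions
  \<open>z\<close>.\<close>

lemma implication:
  assumes m: "monic C m" "m \<in> hom C U B" and n: "monic C n" "n \<in> hom C V B"
  obtains k K where "k \<in> hom C K B" "monic C k"
    "\<And>W w. w \<in> hom C W B \<Longrightarrow> sub_le C w k \<longleftrightarrow>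
      (\<forall>Z z. z \<in> hom C Z W \<longrightarrow> sub_le C (w \<cdot> z) m \<longrightarrow> sub_le C (w \<cdot> z) n)"
proof -
  obtain l L where l: "l \<in> hom C L B" "monic C l"
    "\<And>W w. w \<in> hom C W B \<Longrightarrow> sub_le C w l \<longleftrightarrow> sub_le C w m \<and> sub_le C w n"
    by (rule intersection[OF m n]) (rule that; blast)
  obtain \<chi> where \<chi>: "\<chi> \<in> hom C B omega"
    "\<And>V v. v \<in> hom C V B \<Longrightarrow> \<chi> \<cdot> v = tr V \<longleftrightarrow> sub_le C v m" by (rule classify[OF m]) (rule that; blast)
  obtain \<psi> where \<psi>: "\<psi> \<in> hom C B omega"
    "\<And>V v. v \<in> hom C V B \<Longrightarrow> \<psi> \<cdot> v = tr V \<longleftrightarrow> sub_le C v l" by (rule classify[OF l(2,1)]) (rule that; blast)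
  obtain k K where k: "k \<in> hom C K B" "monic C k"
    "\<And>V v. v \<in> hom C V B \<Longrightarrow> sub_le C v k \<longleftrightarrow> \<chi> \<cdot> v = \<psi> \<cdot> v"
    by (rule equalizer[OF \<chi>(1) \<psi>(1)]) (rule that; blast)
  note [simp] = homE[OF \<chi>(1)] homE[OF \<psi>(1)]
  show thesis
  proof (rule that[OF k(1,2)])
    fix W w assume w: "w \<in> hom C W B"
    note [simp] = homE[OF w]
    \<comment> \<open>Extensionality of \<open>omega\<close> at stage \<open>W\<close> replaces the
      equality by agreement after every restriction \<open>z\<close>; this is the source of the
      quantifier.\<close>
    have "\<chi> \<cdot> w = \<psi> \<cdot> w \<longleftrightarrow>
      (\<forall>Z z. z \<in> hom C Z W \<longrightarrow> ((\<chi> \<cdot> w) \<cdot> z = tr Z \<longleftrightarrow> (\<psi> \<cdot> w) \<cdot> z = tr Z))"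
      using omega_ext[OF Comp_hom[OF w \<chi>(1)] Comp_hom[OF w \<psi>(1)]] by auto
    also have "\<dots> \<longleftrightarrow> (\<forall>Z z. z \<in> hom C Z W \<longrightarrow> (sub_le C (w \<cdot> z) m \<longleftrightarrow> sub_le C (w \<cdot> z) l))"
    proof (intro iff_allI imp_cong refl)
      fix Z z assume z: "z \<in> hom C Z W"
      show "((\<chi> \<cdot> w) \<cdot> z = tr Z \<longleftrightarrow> (\<psi> \<cdot> w) \<cdot> z = tr Z) = (sub_le C (w \<cdot> z) m \<longleftrightarrow> sub_le C (w \<cdot> z) l)"
        using \<chi>(2)[OF Comp_hom[OF z w]] \<psi>(2)[OF Comp_hom[OF z w]] homE[OF z] by simp
    qed
    also have "\<dots> \<longleftrightarrow> (\<forall>Z z. z \<in> hom C Z W \<longrightarrow> sub_le C (w \<cdot> z) m \<longrightarrow> sub_le C (w \<cdot> z) n)"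
      using l(3) Comp_hom[OF _ w] by blast
    finally show "sub_le C w k \<longleftrightarrow> \<dots>" using k(3)[OF w] by simp
  qed
qed

end

section \<open>Disjoint-injective objects and covers\<close>

context category
begin

lemma sub_le_post_comp:
  assumes "sub_le C v m" "v \<in> hom C V U" "m \<in> hom C W U" "n \<in> hom C U B"
  shows "sub_le C (n \<cdot> v) (n \<cdot> m)"
proof -
  obtain u where u: "u \<in> hom C V W" "m \<cdot> u = v" using sub_leE[OF assms(1-3)] .
  show ?thesis
    by (rule sub_leI[OF Comp_hom[OF assms(3,4)] u(1)])
      (use homE[OF u(1)] homE[OF assms(3)] homE[OF assms(4)] in \<open>simp add: u(2)[symmetric]\<close>)
qed

definition disjoint :: "'m \<Rightarrow> 'm \<Rightarrow> bool" where
  "disjoint m n \<longleftrightarrow> (\<forall>v. sub_le C v m \<longrightarrow> sub_le C v n \<longrightarrow> initial C (Dom C v))"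

text \<open>The join of \<open>m\<close> and \<open>n\<close> is all of \<open>B\<close>, phrased
  through upper bounds so that no union has to be constructed.\<close>

definition covers :: "'o \<Rightarrow> 'm \<Rightarrow> 'm \<Rightarrow> bool" where
  "covers B m n \<longleftrightarrow> (\<forall>W w. w \<in> hom C W B \<longrightarrow> monic C w \<longrightarrow> sub_le C m w \<longrightarrow> sub_le C n w \<longrightarrow>
    sub_le C (Id C B) w)"

text \<open>Injectivity along disjoint unions inside \<open>B\<close>, phrased for pairs of maps so
  that it makes sense before any coproduct is known to exist.\<close>

definition disjoint_injective :: "'o \<Rightarrow> bool" where
  "disjoint_injective A \<longleftrightarrow> A \<in> Ob C \<and> (\<forall>B U V m n f g.
    m \<in> hom C U B \<longrightarrow> monic C m \<longrightarrow> n \<in> hom C V B \<longrightarrow> monic C n \<longrightarrow> disjoint m n \<longrightarrow>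
    f \<in> hom C U A \<longrightarrow> g \<in> hom C V A \<longrightarrow> (\<exists>h \<in> hom C B A. h \<cdot> m = f \<and> h \<cdot> n = g))"

lemma disjointD:
  assumes "disjoint m n" "v \<in> hom C V B" "sub_le C v m" "sub_le C v n"
  shows "initial C V"
  using assms unfolding disjoint_def hom_def by blast

lemma disjoint_sym: "disjoint m n \<Longrightarrow> disjoint n m"
  unfolding disjoint_def by blast

lemma disjoint_injectiveE:
  assumes "disjoint_injective A" "m \<in> hom C U B" "monic C m" "n \<in> hom C V B" "monic C n"
    "disjoint m n" "f \<in> hom C U A" "g \<in> hom C V A"
  obtains h where "h \<in> hom C B A" "h \<cdot> m = f" "h \<cdot> n = g"
  using assms(1)[unfolded disjoint_injective_def, THEN conjunct2, rule_format, OF assms(2-)] that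
  by blast

lemma coversD:
  assumes "covers B m n" "w \<in> hom C W B" "monic C w" "sub_le C m w" "sub_le C n w"
  shows "sub_le C (Id C B) w"
  using assms unfolding covers_def by blast

end

context topos
begin

text \<open>Arrows from the product \<open>Q\<close> of \<open>Z\<close> and \<open>V\<close> to
  \<open>Y\<close> correspond to arrows from \<open>Z\<close> to an exponential, so any two agree.
  Restricting along \<open>d\<close>, the pair of \<open>v\<close> and the identity, any two arrows
  from \<open>V\<close> to \<open>Y\<close> agree; one exists through \<open>v\<close>.\<close>

lemma strict_initial:
  assumes Z: "initial C Z" and v: "v \<in> hom C V Z"
  shows "initial C V"
  unfolding initial_def
proof (intro conjI ballI)
  note [simp] = homE[OF v]
  show "V \<in> Ob C" by simp
  fix Y assume Y: "Y \<in> Ob C"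
  obtain E P p q e where E: "exponential C Y V E P p q e" using ex_exponential[OF Y, of V] by auto
  obtain Q r s where Q: "product C Z V Q r s" using product_exists[of Z V] by auto
  obtain d where d: "d \<in> hom C V Q" "r \<cdot> d = v" "s \<cdot> d = Id C V"
    using product_pair[OF Q v Id_hom] by auto
  note [simp] = homE[OF d(1)] homE[OF productD(1)[OF Q]] homE[OF productD(2)[OF Q]]
  have eq: "f = g" if f: "f \<in> hom C V Y" and g: "g \<in> hom C V Y" for f g
  proof -
    note [simp] = homE[OF f] homE[OF g]
    obtain h k where h: "h \<in> hom C Z E" "k \<in> hom C Q P" "p \<cdot> k = h \<cdot> r" "q \<cdot> k = s" "e \<cdot> k = f \<cdot> s"
      using transpose_ex[OF E Q Comp_hom[OF productD(2)[OF Q] f]] .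
    obtain h' k' where h': "h' \<in> hom C Z E" "k' \<in> hom C Q P" "p \<cdot> k' = h' \<cdot> r" "q \<cdot> k' = s" "e \<cdot> k' = g \<cdot> s"
      using transpose_ex[OF E Q Comp_hom[OF productD(2)[OF Q] g]] .
    have "h = h'" using initial_eq[OF Z h(1) h'(1)] .
    then have "k = k'" using product_eqI[OF exponentialD(1)[OF E] h(2) h'(2)] h h' by simp
    then have "f \<cdot> s = g \<cdot> s" using h h' by simp
    then have "(f \<cdot> s) \<cdot> d = (g \<cdot> s) \<cdot> d" by simp
    then show "f = g" using d(3) by simp
  qed
  obtain i where "i \<in> hom C Z Y" using initial_ex[OF Z Y] by blast
  then have "i \<cdot> v \<in> hom C V Y" using Comp_hom[OF v] by blast
  then show "\<exists>!f. f \<in> hom C V Y" using eq by blast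
qed

text \<open>On elements of \<open>m\<close> the first implication reduces to \<open>\<phi>\<close>
  and the second is vacuous by disjointness. The lemma is applied twice, the second time with the
  roles of \<open>m\<close> and \<open>n\<close> exchanged.\<close>

lemma restrict_implications:
  assumes m: "m \<in> hom C U B" "monic C m" and n: "n \<in> hom C V B" and disj: "disjoint m n"
    and f: "f \<in> hom C U omega" and \<phi>: "\<phi> \<in> hom C F U"
      "\<And>W w. w \<in> hom C W U \<Longrightarrow> f \<cdot> w = tr W \<longleftrightarrow> sub_le C w \<phi>"
    and \<psi>: "\<psi> \<in> hom C G V" and h: "h \<in> hom C B omega"
      "\<And>W w. w \<in> hom C W B \<Longrightarrow> h \<cdot> w = tr W \<longleftrightarrow>
        (\<forall>Z z. z \<in> hom C Z W \<longrightarrow> sub_le C (w \<cdot> z) m \<longrightarrow> sub_le C (w \<cdot> z) (m \<cdot> \<phi>)) \<and>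
        (\<forall>Z z. z \<in> hom C Z W \<longrightarrow> sub_le C (w \<cdot> z) n \<longrightarrow> sub_le C (w \<cdot> z) (n \<cdot> \<psi>))"
  shows "h \<cdot> m = f"
proof (rule omega_ext[OF Comp_hom[OF m(1) h(1)] f])
  fix W w assume w: "w \<in> hom C W U"
  note [simp] = homE[OF w] homE[OF m(1)] homE[OF h(1)]
  have mw: "m \<cdot> w \<in> hom C W B" using Comp_hom[OF w m(1)] .
  have mw_le: "sub_le C (m \<cdot> w) m" using sub_leI[OF m(1) w] by blast
  \<comment> \<open>An element of both \<open>m\<close> and \<open>n\<close> has an initial domain,
    and an arrow from an initial object factors through anything.\<close>
  have 2: "sub_le C ((m \<cdot> w) \<cdot> z) (n \<cdot> \<psi>)" if "z \<in> hom C Z W" "sub_le C ((m \<cdot> w) \<cdot> z) n" for Z z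
  proof -
    have z: "(m \<cdot> w) \<cdot> z \<in> hom C Z B" using Comp_hom[OF that(1) mw] .
    have "initial C Z"
      using disjointD[OF disj z sub_le_comp[OF mw_le mw m(1) that(1)] that(2)] .
    then show ?thesis using initial_sub_le[OF _ z Comp_hom[OF \<psi> n]] by blast
  qed
  have "(\<forall>Z z. z \<in> hom C Z W \<longrightarrow> sub_le C ((m \<cdot> w) \<cdot> z) m \<longrightarrow> sub_le C ((m \<cdot> w) \<cdot> z) (m \<cdot> \<phi>))
    \<longleftrightarrow> sub_le C w \<phi>" (is "?L \<longleftrightarrow> _")
  proof
    assume ?L
    then have "sub_le C ((m \<cdot> w) \<cdot> Id C W) m \<longrightarrow> sub_le C ((m \<cdot> w) \<cdot> Id C W) (m \<cdot> \<phi>)"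
      using Id_hom[OF homE(4)[OF w]] by blast
    then have "sub_le C (m \<cdot> w) (m \<cdot> \<phi>)" using mw_le by simp
    then show "sub_le C w \<phi>" using sub_le_monic_cancel[OF _ m(2,1) w \<phi>(1)] by simp
  next
    assume le: "sub_le C w \<phi>"
    show ?L
      using sub_le_comp[OF sub_le_post_comp[OF le w \<phi>(1) m(1)] mw Comp_hom[OF \<phi>(1) m(1)]] by blast
  qed
  then show "(h \<cdot> m) \<cdot> w = tr W \<longleftrightarrow> f \<cdot> w = tr W"
    using h(2)[OF mw] 2 \<phi>(2)[OF w] by simp
qed

text \<open>With \<open>\<phi>\<close> and \<open>\<psi>\<close> the extents of \<open>f\<close> and
  \<open>g\<close>, the extension classifies the intersection of two implications, from
  \<open>m\<close> to \<open>m \<cdot> \<phi>\<close> and from \<open>n\<close> to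
  \<open>n \<cdot> \<psi>\<close>. These take the place of a union of the extents.\<close>

lemma omega_disjoint_injective: "disjoint_injective omega"
  unfolding disjoint_injective_def
proof (intro conjI allI impI)
  fix B U V m n f g
  assume m: "m \<in> hom C U B" "monic C m" and n: "n \<in> hom C V B" "monic C n" and disj: "disjoint m n"
    and f: "f \<in> hom C U omega" and g: "g \<in> hom C V omega"
  obtain \<phi> F where \<phi>: "\<phi> \<in> hom C F U" "monic C \<phi>"
    "\<And>W w. w \<in> hom C W U \<Longrightarrow> f \<cdot> w = tr W \<longleftrightarrow> sub_le C w \<phi>"
    by (rule comprehension[OF f]) (rule that; blast)
  obtain \<psi> G where \<psi>: "\<psi> \<in> hom C G V" "monic C \<psi>"
    "\<And>W w. w \<in> hom C W V \<Longrightarrow> g \<cdot> w = tr W \<longleftrightarrow> sub_le C w \<psi>"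
    by (rule comprehension[OF g]) (rule that; blast)
  obtain k K where k: "k \<in> hom C K B" "monic C k"
    "\<And>W w. w \<in> hom C W B \<Longrightarrow> sub_le C w k \<longleftrightarrow>
      (\<forall>Z z. z \<in> hom C Z W \<longrightarrow> sub_le C (w \<cdot> z) m \<longrightarrow> sub_le C (w \<cdot> z) (m \<cdot> \<phi>))"
    by (rule implication[OF m(2,1) monic_comp[OF m(2,1) \<phi>(2,1)] Comp_hom[OF \<phi>(1) m(1)]])
      (rule that; blast)
  obtain l L where l: "l \<in> hom C L B" "monic C l"
    "\<And>W w. w \<in> hom C W B \<Longrightarrow> sub_le C w l \<longleftrightarrow>
      (\<forall>Z z. z \<in> hom C Z W \<longrightarrow> sub_le C (w \<cdot> z) n \<longrightarrow> sub_le C (w \<cdot> z) (n \<cdot> \<psi>))"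
    by (rule implication[OF n(2,1) monic_comp[OF n(2,1) \<psi>(2,1)] Comp_hom[OF \<psi>(1) n(1)]])
      (rule that; blast)
  obtain j J where j: "j \<in> hom C J B" "monic C j"
    "\<And>W w. w \<in> hom C W B \<Longrightarrow> sub_le C w j \<longleftrightarrow> sub_le C w k \<and> sub_le C w l"
    by (rule intersection[OF k(2,1) l(2,1)]) (rule that; blast)
  obtain h where h: "h \<in> hom C B omega"
    "\<And>W w. w \<in> hom C W B \<Longrightarrow> h \<cdot> w = tr W \<longleftrightarrow> sub_le C w j"
    by (rule classify[OF j(2,1)]) (rule that; blast)
  have "h \<cdot> m = f"
    using restrict_implications[OF m n(1) disj f \<phi>(1,3) \<psi>(1) h(1)] h(2) j(3) k(3) l(3) by simp
  moreover have "h \<cdot> n = g"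
    using restrict_implications[OF n m(1) disjoint_sym[OF disj] g \<psi>(1,3) \<phi>(1) h(1)]
      h(2) j(3) k(3) l(3) by (simp add: conj_commute)
  ultimately show "\<exists>h \<in> hom C B omega. h \<cdot> m = f \<and> h \<cdot> n = g" using h(1) by blast
qed simp

text \<open>Uncurrying yields an extension problem for \<open>A\<close> along
  \<open>m \<times> X\<close> and \<open>n \<times> X\<close>, which are again monic and disjoint;
  its solution \<open>H\<close> is curried back to \<open>h\<close>.\<close>

lemma exponential_disjoint_injective:
  assumes A: "disjoint_injective A" and E: "exponential C A X E P p q e"
  shows "disjoint_injective E"
  unfolding disjoint_injective_def
proof (intro conjI allI impI)
  note [simp] = homE[OF exponentialD(2)[OF E]] homE[OF productD(1)[OF exponentialD(1)[OF E]]]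
    homE[OF productD(2)[OF exponentialD(1)[OF E]]]
  show "E \<in> Ob C" by simp
  fix B U V m n f g
  assume m: "m \<in> hom C U B" "monic C m" and n: "n \<in> hom C V B" "monic C n" and disj: "disjoint m n"
    and f: "f \<in> hom C U E" and g: "g \<in> hom C V E"
  note [simp] = homE[OF m(1)] homE[OF n(1)]
  obtain R \<rho> \<sigma> where R: "product C B X R \<rho> \<sigma>" using product_exists[of B X] by auto
  note [simp] = homE[OF productD(1)[OF R]] homE[OF productD(2)[OF R]]
  \<comment> \<open>\<open>M\<close> is \<open>m \<times> X\<close> and \<open>k\<close> is
    \<open>f \<times> X\<close>, so that \<open>e \<cdot> k\<close> is the uncurried
    \<open>f\<close>.\<close>
  have lift: "\<exists>Q r s M k. product C U X Q r s \<and> M \<in> hom C Q R \<and> monic C M \<and> \<rho> \<cdot> M = m \<cdot> r \<and> \<sigma> \<cdot> M = s \<and>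
      k \<in> hom C Q P \<and> p \<cdot> k = f \<cdot> r \<and> q \<cdot> k = s"
    if m: "m \<in> hom C U B" "monic C m" and f: "f \<in> hom C U E" for m U f
  proof -
    note [simp] = homE[OF m(1)] homE[OF f]
    obtain Q r s where Q: "product C U X Q r s" using product_exists[of U X] by auto
    note [simp] = homE[OF productD(1)[OF Q]] homE[OF productD(2)[OF Q]]
    obtain M where M: "M \<in> hom C Q R" "\<rho> \<cdot> M = m \<cdot> r" "\<sigma> \<cdot> M = s"
      using product_pair[OF R Comp_hom[OF productD(1)[OF Q] m(1)] productD(2)[OF Q]] .
    obtain k where k: "k \<in> hom C Q P" "p \<cdot> k = f \<cdot> r" "q \<cdot> k = s"
      using product_pair[OF exponentialD(1)[OF E] Comp_hom[OF productD(1)[OF Q] f] productD(2)[OF Q]] .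
    note [simp] = homE[OF M(1)]
    have "monic C M"
    proof (rule monicI[OF M(1)])
      fix Z a b assume a: "a \<in> hom C Z Q" and b: "b \<in> hom C Z Q" and eq: "M \<cdot> a = M \<cdot> b"
      note [simp] = homE[OF a] homE[OF b]
      have "m \<cdot> r \<cdot> a = m \<cdot> r \<cdot> b"
        using comp_reassoc[OF M(2), of a] comp_reassoc[OF M(2), of b] eq by simp
      then have "r \<cdot> a = r \<cdot> b"
        using monicD[OF m(2,1) _ Comp_hom[OF a productD(1)[OF Q]] Comp_hom[OF b productD(1)[OF Q]]]
        by simp
      moreover have "s \<cdot> a = s \<cdot> b"
        using comp_reassoc[OF M(3), of a] comp_reassoc[OF M(3), of b] eq by simp
      ultimately show "a = b" using product_eqI[OF Q a b] by blast
    qed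
    then show ?thesis using Q M k by blast
  qed
  obtain Q r s M k where M: "product C U X Q r s" "M \<in> hom C Q R" "monic C M" "\<rho> \<cdot> M = m \<cdot> r" "\<sigma> \<cdot> M = s"
    and k: "k \<in> hom C Q P" "p \<cdot> k = f \<cdot> r" "q \<cdot> k = s" using lift[OF m f] by blast
  obtain Q' r' s' N l where N: "product C V X Q' r' s'" "N \<in> hom C Q' R" "monic C N" "\<rho> \<cdot> N = n \<cdot> r'" "\<sigma> \<cdot> N = s'"
    and l: "l \<in> hom C Q' P" "p \<cdot> l = g \<cdot> r'" "q \<cdot> l = s'" using lift[OF n g] by blast
  note [simp] = homE[OF productD(1)[OF M(1)]] homE[OF productD(2)[OF M(1)]] homE[OF M(2)]
    homE[OF productD(1)[OF N(1)]] homE[OF productD(2)[OF N(1)]] homE[OF N(2)]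
    homE[OF k(1)] homE[OF l(1)] homE[OF f] homE[OF g]
  have "disjoint M N"
    unfolding disjoint_def
  proof (intro allI impI)
    fix v assume v: "sub_le C v M" "sub_le C v N"
    then obtain a b where a: "a \<in> hom C (Dom C v) Q" "M \<cdot> a = v" and b: "b \<in> hom C (Dom C v) Q'" "N \<cdot> b = v"
      unfolding sub_le_def by auto
    note [simp] = homE[OF a(1)] homE[OF b(1)]
    have eq: "m \<cdot> r \<cdot> a = n \<cdot> r' \<cdot> b"
      using comp_reassoc[OF M(4), of a] comp_reassoc[OF N(4), of b] a(2) b(2) by simp
    have ra: "r \<cdot> a \<in> hom C (Dom C v) U" and rb: "r' \<cdot> b \<in> hom C (Dom C v) V"
      using Comp_hom[OF a(1) productD(1)[OF M(1)]] Comp_hom[OF b(1) productD(1)[OF N(1)]] by auto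
    show "initial C (Dom C v)"
      by (rule disjointD[OF disj Comp_hom[OF ra m(1)] sub_leI[OF m(1) ra refl]
          sub_leI[OF n(1) rb eq[symmetric]]])
  qed
  then obtain H where H: "H \<in> hom C R A" "H \<cdot> M = e \<cdot> k" "H \<cdot> N = e \<cdot> l"
    using disjoint_injectiveE[OF A M(2,3) N(2,3) _ Comp_hom[OF k(1) exponentialD(2)[OF E]]
        Comp_hom[OF l(1) exponentialD(2)[OF E]]] by blast
  obtain h \<kappa> where h: "h \<in> hom C B E" "\<kappa> \<in> hom C R P" "p \<cdot> \<kappa> = h \<cdot> \<rho>" "q \<cdot> \<kappa> = \<sigma>" "e \<cdot> \<kappa> = H"
    using transpose_ex[OF E R H(1)] .
  note [simp] = homE[OF h(1)] homE[OF h(2)]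
  have "h \<cdot> m = f"
    by (rule transpose_eqI[OF E M(1) Comp_hom[OF m(1) h(1)] Comp_hom[OF M(2) h(2)] _ _ f k])
      (use comp_reassoc[OF h(3), of M] comp_reassoc[OF h(4), of M] comp_reassoc[OF h(5), of M] M(4,5) H(2)
        in auto)
  moreover have "h \<cdot> n = g"
    by (rule transpose_eqI[OF E N(1) Comp_hom[OF n(1) h(1)] Comp_hom[OF N(2) h(2)] _ _ g l])
      (use comp_reassoc[OF h(3), of N] comp_reassoc[OF h(4), of N] comp_reassoc[OF h(5), of N] N(4,5) H(3)
        in auto)
  ultimately show "\<exists>h \<in> hom C B E. h \<cdot> m = f \<and> h \<cdot> n = g" using h(1) by blast
qed

text \<open>\<open>\<sigma>\<close> is the transpose of the equality predicate
  \<open>\<chi>\<close>. If \<open>\<sigma>\<close> identifies \<open>f\<close> and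
  \<open>g\<close>, then \<open>\<chi>\<close> takes the same value at the pairs
  \<open>(f, g)\<close> and \<open>(g, g)\<close>, and it is true at the latter.\<close>

lemma singleton_monic:
  assumes X: "X \<in> Ob C" and E: "exponential C omega X E P p q e"
  obtains \<sigma> where "\<sigma> \<in> hom C X E" "monic C \<sigma>"
proof -
  obtain Q r s where Q: "product C X X Q r s" using product_exists[OF X X] .
  note [simp] = X homE[OF productD(1)[OF Q]] homE[OF productD(2)[OF Q]]
  obtain d where d: "d \<in> hom C X Q" "r \<cdot> d = Id C X" "s \<cdot> d = Id C X"
    using product_pair[OF Q Id_hom Id_hom] by auto
  obtain \<chi> where \<chi>: "\<chi> \<in> hom C Q omega"
    "\<And>V v. v \<in> hom C V Q \<Longrightarrow> \<chi> \<cdot> v = tr V \<longleftrightarrow> sub_le C v d"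
    by (rule classify[OF split_monic[OF d(1) productD(1)[OF Q] d(2)] d(1)]) (rule that; blast)
  obtain \<sigma> k where \<sigma>: "\<sigma> \<in> hom C X E" "k \<in> hom C Q P" "p \<cdot> k = \<sigma> \<cdot> r" "q \<cdot> k = s" "e \<cdot> k = \<chi>"
    using transpose_ex[OF E Q \<chi>(1)] .
  note [simp] = homE[OF \<sigma>(1)] homE[OF \<sigma>(2)] homE[OF exponentialD(2)[OF E]]
    homE[OF productD(1)[OF exponentialD(1)[OF E]]] homE[OF productD(2)[OF exponentialD(1)[OF E]]]
  have "monic C \<sigma>"
  proof (rule monicI[OF \<sigma>(1)])
    fix Z f g assume f: "f \<in> hom C Z X" and g: "g \<in> hom C Z X" and eq: "\<sigma> \<cdot> f = \<sigma> \<cdot> g"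
    obtain a where a: "a \<in> hom C Z Q" "r \<cdot> a = f" "s \<cdot> a = g" using product_pair[OF Q f g] .
    obtain b where b: "b \<in> hom C Z Q" "r \<cdot> b = g" "s \<cdot> b = g" using product_pair[OF Q g g] .
    note [simp] = homE[OF a(1)] homE[OF b(1)]
    have "k \<cdot> a = k \<cdot> b"
      by (rule product_eqI[OF exponentialD(1)[OF E] Comp_hom[OF a(1) \<sigma>(2)] Comp_hom[OF b(1) \<sigma>(2)]])
        (use comp_reassoc[OF \<sigma>(3), of a] comp_reassoc[OF \<sigma>(3), of b] comp_reassoc[OF \<sigma>(4), of a]
          comp_reassoc[OF \<sigma>(4), of b] a b eq in auto)
    then have "\<chi> \<cdot> a = \<chi> \<cdot> b"
      using comp_reassoc[OF \<sigma>(5), of a] comp_reassoc[OF \<sigma>(5), of b] by simp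
    moreover have "\<chi> \<cdot> b = tr Z" using \<chi>(2)[OF b(1)] diagonal_le_iff[OF Q d b(1)] b by simp
    ultimately show "f = g" using \<chi>(2)[OF a(1)] diagonal_le_iff[OF Q d a(1)] a by simp
  qed
  then show thesis using that \<sigma>(1) by blast
qed

text \<open>
  Pulling back along \<open>f\<close> preserves covers. The subobject \<open>w\<close> of \<open>A\<close> is transported along the
  graph of \<open>f\<close> to a predicate on \<open>B \<times> A\<close>, whose transpose \<open>B \<rightarrow> \<Omega>\<^sup>A\<close> can be tested on the cover of
  \<open>B\<close>; this plays the role of universal quantification along \<open>f\<close>.
\<close>

lemma covers_pullback:
  assumes cov: "covers B m n" and m: "m \<in> hom C U B" and n: "n \<in> hom C V B"
    and f: "f \<in> hom C A B" and w: "w \<in> hom C W A" "monic C w"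
    and le: "\<And>Z z. z \<in> hom C Z A \<Longrightarrow> sub_le C (f \<cdot> z) m \<or> sub_le C (f \<cdot> z) n \<Longrightarrow> sub_le C z w"
  shows "sub_le C (Id C A) w"
proof -
  note [simp] = homE[OF m] homE[OF n] homE[OF f] homE[OF w(1)]
  obtain Q r s where Q: "product C B A Q r s" using product_exists[of B A] by auto
  note [simp] = homE[OF productD(1)[OF Q]] homE[OF productD(2)[OF Q]]
  obtain \<gamma> where \<gamma>: "\<gamma> \<in> hom C A Q" "r \<cdot> \<gamma> = f" "s \<cdot> \<gamma> = Id C A"
    using product_pair[OF Q f Id_hom] by auto
  have \<gamma>m: "monic C \<gamma>" by (rule split_monic[OF \<gamma>(1) productD(2)[OF Q] \<gamma>(3)])
  \<comment> \<open>With \<open>\<gamma>\<close> the graph of \<open>f\<close>, membership of a pair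
    \<open>(b, a)\<close> in \<open>\<kappa>\<close> means: if \<open>b = f a\<close>, then
    \<open>a\<close> lies in \<open>w\<close>.\<close>
  obtain \<kappa> K where \<kappa>: "\<kappa> \<in> hom C K Q" "monic C \<kappa>"
    "\<And>Z z. z \<in> hom C Z Q \<Longrightarrow> sub_le C z \<kappa> \<longleftrightarrow>
      (\<forall>Y y. y \<in> hom C Y Z \<longrightarrow> sub_le C (z \<cdot> y) \<gamma> \<longrightarrow> sub_le C (z \<cdot> y) (\<gamma> \<cdot> w))"
    by (rule implication[OF \<gamma>m \<gamma>(1) monic_comp[OF \<gamma>m \<gamma>(1) w(2,1)] Comp_hom[OF w(1) \<gamma>(1)]])
      (rule that; blast)
  obtain \<chi> where \<chi>: "\<chi> \<in> hom C Q omega"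
    "\<And>Z z. z \<in> hom C Z Q \<Longrightarrow> \<chi> \<cdot> z = tr Z \<longleftrightarrow> sub_le C z \<kappa>"
    by (rule classify[OF \<kappa>(2,1)]) (rule that; blast)
  obtain E P p q e where E: "exponential C omega A E P p q e" using ex_exponential[of omega A] by auto
  obtain h k where h: "h \<in> hom C B E" "k \<in> hom C Q P" "p \<cdot> k = h \<cdot> r" "q \<cdot> k = s" "e \<cdot> k = \<chi>"
    using transpose_ex[OF E Q \<chi>(1)] .
  \<comment> \<open>The transpose \<open>h'\<close> of the true predicate is compared with
    \<open>h\<close>: they agree at an element of \<open>B\<close> when the implication holds there
    for all elements of \<open>A\<close>.\<close>
  have trQ: "tr Q \<in> hom C Q omega" by (rule tr_hom) simp
  obtain h' k' where h': "h' \<in> hom C B E" "k' \<in> hom C Q P" "p \<cdot> k' = h' \<cdot> r" "q \<cdot> k' = s" "e \<cdot> k' = tr Q"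
    using transpose_ex[OF E Q trQ] .
  note [simp] = homE[OF h(1)] homE[OF h(2)] homE[OF h'(1)] homE[OF h'(2)] homE[OF \<gamma>(1)]
    homE[OF exponentialD(2)[OF E]]
    homE[OF productD(1)[OF exponentialD(1)[OF E]]] homE[OF productD(2)[OF exponentialD(1)[OF E]]]
  obtain d D where d: "d \<in> hom C D B" "monic C d"
    "\<And>Z z. z \<in> hom C Z B \<Longrightarrow> sub_le C z d \<longleftrightarrow> h \<cdot> z = h' \<cdot> z"
    by (rule equalizer[OF h(1) h'(1)]) (rule that; blast)
  have agree: "sub_le C m d" if m: "m \<in> hom C U B"
    and le: "\<And>Z z. z \<in> hom C Z A \<Longrightarrow> sub_le C (f \<cdot> z) m \<Longrightarrow> sub_le C z w" for m U
  proof -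
    note [simp] = homE[OF m]
    obtain Qm rm sm where Qm: "product C U A Qm rm sm" using product_exists[of U A] by auto
    note [simp] = homE[OF productD(1)[OF Qm]] homE[OF productD(2)[OF Qm]]
    obtain M where M: "M \<in> hom C Qm Q" "r \<cdot> M = m \<cdot> rm" "s \<cdot> M = sm"
      using product_pair[OF Q Comp_hom[OF productD(1)[OF Qm] m] productD(2)[OF Qm]] .
    note [simp] = homE[OF M(1)]
    have "sub_le C (M \<cdot> y) (\<gamma> \<cdot> w)" if y: "y \<in> hom C Y Qm" and yle: "sub_le C (M \<cdot> y) \<gamma>" for Y y
    proof -
      note [simp] = homE[OF y]
      obtain x where x: "x \<in> hom C Y A" "\<gamma> \<cdot> x = M \<cdot> y"
        using sub_leE[OF yle Comp_hom[OF y M(1)] \<gamma>(1)] .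
      note [simp] = homE[OF x(1)]
      have eq: "m \<cdot> rm \<cdot> y = f \<cdot> x"
        using comp_reassoc[OF \<gamma>(2), of x] comp_reassoc[OF M(2), of y] x(2) by simp
      have "sub_le C (f \<cdot> x) m" by (rule sub_leI[OF m Comp_hom[OF y productD(1)[OF Qm]] eq])
      then have "sub_le C x w" using le x(1) by blast
      then show ?thesis using sub_le_post_comp[OF _ x(1) w(1) \<gamma>(1)] x(2) by simp
    qed
    then have "\<chi> \<cdot> M = tr Qm" using \<chi>(2)[OF M(1)] \<kappa>(3)[OF M(1)] by blast
    then have eq: "\<chi> \<cdot> M = tr Q \<cdot> M" using tr_comp[OF M(1)] by simp
    have "h \<cdot> m = h' \<cdot> m"
      by (rule transpose_eqI[OF E Qm Comp_hom[OF m h(1)] Comp_hom[OF M(1) h(2)] _ _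
            Comp_hom[OF m h'(1)] Comp_hom[OF M(1) h'(2)]])
        (use comp_reassoc[OF h(3), of M] comp_reassoc[OF h(4), of M] comp_reassoc[OF h(5), of M]
          comp_reassoc[OF h'(3), of M] comp_reassoc[OF h'(4), of M] comp_reassoc[OF h'(5), of M]
          M(2,3) eq in auto)
    then show ?thesis using d(3)[OF m] by blast
  qed
  have "sub_le C (Id C B) d" by (rule coversD[OF cov d(1,2) agree[OF m] agree[OF n]]) (use le in blast)+
  then have "h = h'" using d(3)[OF Id_hom] by simp
  then have "k = k'" using product_eqI[OF exponentialD(1)[OF E] h(2) h'(2)] h h' by simp
  then have "\<chi> = tr Q" using h(5) h'(5) by simp
  \<comment> \<open>On the graph itself the premise of the implication holds, which leaves
    membership in \<open>w\<close>.\<close>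
  then have "sub_le C \<gamma> \<kappa>" using \<chi>(2)[OF \<gamma>(1)] tr_comp[OF \<gamma>(1)] by simp
  then have "sub_le C (\<gamma> \<cdot> Id C A) \<gamma> \<longrightarrow> sub_le C (\<gamma> \<cdot> Id C A) (\<gamma> \<cdot> w)"
    using \<kappa>(3)[OF \<gamma>(1)] Id_hom[OF homE(4)[OF f]] by blast
  then have "sub_le C \<gamma> (\<gamma> \<cdot> w)" using sub_le_refl[OF \<gamma>(1)] by simp
  then show ?thesis using sub_le_monic_cancel[OF _ \<gamma>m \<gamma>(1) Id_hom w(1)] by simp
qed

definition complementary :: "'o \<Rightarrow> 'o \<Rightarrow> 'o \<Rightarrow> 'm \<Rightarrow> 'm \<Rightarrow> bool" where
  "complementary U V B m n \<longleftrightarrow> m \<in> hom C U B \<and> monic C m \<and> n \<in> hom C V B \<and> monic C n \<and>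
    disjoint m n \<and> covers B m n"

text \<open>\<open>\<sigma>\<close> embeds \<open>Z\<close> in a disjoint-injective power of
  \<open>omega\<close>, where \<open>f\<close> and \<open>g\<close> have a common extension
  \<open>h\<close>. The inverse image of \<open>\<sigma>\<close> under \<open>h\<close> contains
  \<open>m\<close> and \<open>n\<close>, hence is everything, so \<open>h\<close> factors through
  \<open>\<sigma>\<close>. Uniqueness holds because an equalizer containing \<open>m\<close> and
  \<open>n\<close> is everything.\<close>

lemma complementary_coproduct:
  assumes "complementary U V B m n"
  shows "coproduct C U V B m n"
  unfolding coproduct_def
proof (intro conjI ballI)
  have m: "m \<in> hom C U B" "monic C m" and n: "n \<in> hom C V B" "monic C n"
    and disj: "disjoint m n" and cov: "covers B m n"
    using assms unfolding complementary_def by auto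
  note [simp] = homE[OF m(1)] homE[OF n(1)]
  show "m \<in> hom C U B" "n \<in> hom C V B" using m n by auto
  fix Z f g assume Z: "Z \<in> Ob C" and f: "f \<in> hom C U Z" and g: "g \<in> hom C V Z"
  note [simp] = homE[OF f] homE[OF g]
  obtain E P p q e where E: "exponential C omega Z E P p q e" using ex_exponential[of omega Z] Z by auto
  obtain \<sigma> where \<sigma>: "\<sigma> \<in> hom C Z E" "monic C \<sigma>" using singleton_monic[OF Z E] .
  obtain h where h: "h \<in> hom C B E" "h \<cdot> m = \<sigma> \<cdot> f" "h \<cdot> n = \<sigma> \<cdot> g"
    using disjoint_injectiveE[OF exponential_disjoint_injective[OF omega_disjoint_injective E] m n disj
        Comp_hom[OF f \<sigma>(1)] Comp_hom[OF g \<sigma>(1)]] .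
  note [simp] = homE[OF \<sigma>(1)] homE[OF h(1)]
  obtain w W where w: "w \<in> hom C W B" "monic C w"
    "\<And>Y y. y \<in> hom C Y B \<Longrightarrow> sub_le C y w \<longleftrightarrow> sub_le C (h \<cdot> y) \<sigma>"
    by (rule inverse_image[OF h(1) \<sigma>(2,1)]) (rule that; blast)
  have "sub_le C (Id C B) w"
    by (rule coversD[OF cov w(1,2)])
      (use w(3)[OF m(1)] w(3)[OF n(1)] h(2,3) sub_leI[OF \<sigma>(1) f] sub_leI[OF \<sigma>(1) g] in auto)
  then have "sub_le C h \<sigma>" using w(3)[OF Id_hom] by simp
  then obtain x where x: "x \<in> hom C B Z" "\<sigma> \<cdot> x = h" using sub_leE[OF _ h(1) \<sigma>(1)] by blast
  note [simp] = homE[OF x(1)]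
  have xm: "x \<cdot> m = f"
    by (rule monicD[OF \<sigma>(2,1) _ Comp_hom[OF m(1) x(1)] f]) (use comp_reassoc[OF x(2), of m] h(2) in simp)
  have xn: "x \<cdot> n = g"
    by (rule monicD[OF \<sigma>(2,1) _ Comp_hom[OF n(1) x(1)] g]) (use comp_reassoc[OF x(2), of n] h(3) in simp)
  show "\<exists>!h. h \<in> hom C B Z \<and> h \<cdot> m = f \<and> h \<cdot> n = g"
  proof (rule ex1I[of _ x])
    show "x \<in> hom C B Z \<and> x \<cdot> m = f \<and> x \<cdot> n = g" using x(1) xm xn by blast
    fix y assume y: "y \<in> hom C B Z \<and> y \<cdot> m = f \<and> y \<cdot> n = g"
    then have y1: "y \<in> hom C B Z" by blast
    obtain d D where d: "d \<in> hom C D B" "monic C d"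
      "\<And>Z z. z \<in> hom C Z B \<Longrightarrow> sub_le C z d \<longleftrightarrow> y \<cdot> z = x \<cdot> z"
      by (rule equalizer[OF y1 x(1)]) (rule that; blast)
    have "sub_le C (Id C B) d"
      by (rule coversD[OF cov d(1,2)]) (use d(3)[OF m(1)] d(3)[OF n(1)] y xm xn in auto)
    then show "y = x" using d(3)[OF Id_hom] homE[OF y1] by simp
  qed
qed

section \<open>Names of arrows and the degenerate cases\<close>

lemma product_one:
  assumes "X \<in> Ob C"
  shows "product C one X X (bang X) (Id C X)"
  unfolding product_def
proof (intro conjI ballI)
  fix Z f g assume f: "f \<in> hom C Z one" and g: "g \<in> hom C Z X"
  show "\<exists>!h. h \<in> hom C Z X \<and> bang X \<cdot> h = f \<and> Id C X \<cdot> h = g"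
    by (rule ex1I[of _ g]) (use homE[OF g] bang_eq[OF f] in \<open>auto simp: hom_def\<close>)
qed (use assms bang_hom Id_hom in auto)

lemma isomorphism_if_thin:
  assumes thin: "\<And>X Y f g. f \<in> hom C X Y \<Longrightarrow> g \<in> hom C X Y \<Longrightarrow> f = g"
    and f: "f \<in> hom C X Y" and g: "g \<in> hom C Y X"
  shows "isomorphism C f"
  unfolding isomorphism_def
  using homE[OF f] g thin[OF Comp_hom[OF f g] Id_hom] thin[OF Comp_hom[OF g f] Id_hom] by auto

lemma point_if_not_initial:
  assumes "NS C" "X \<in> Ob C" "\<not> initial C X"
  obtains x where "x \<in> hom C one X"
proof -
  obtain T x where T: "terminal C T" "x \<in> hom C T X" using assms unfolding NS_def points_def by blast
  obtain u where "u \<in> hom C one T" using terminal_ex[OF T(1) one_Ob] by blast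
  then show thesis using that Comp_hom[OF _ T(2)] by blast
qed

text \<open>By strictness every object is initial. This case is excluded when
  \<open>quality_type\<close> fails.\<close>

lemma isomorphism_if_initial_one:
  assumes one: "initial C one" and f: "f \<in> hom C X Y"
  shows "isomorphism C f"
proof -
  have init: "initial C Z" if "Z \<in> Ob C" for Z using strict_initial[OF one bang_hom[OF that]] .
  obtain g where g: "g \<in> hom C Y X" using initial_ex[OF init] homE(4,5)[OF f] by blast
  show ?thesis by (rule isomorphism_if_thin[OF initial_eq[OF init] f g]) (simp_all add: homE(4))
qed

text \<open>Supplies, by contraposition, an initial object. Without one, NS gives a point to every
  object, including the equalizer of the names of two parallel arrows, which are therefore
  equal.\<close>

lemma isomorphism_if_no_initial:
  assumes ns: "NS C" and no_init: "\<And>Z. \<not> initial C Z" and f: "f \<in> hom C X Y"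
  shows "isomorphism C f"
proof -
  have thin: "f = g" if f: "f \<in> hom C X Y" and g: "g \<in> hom C X Y" for X Y f g
  proof -
    note [simp] = homE[OF f] homE[OF g]
    obtain E P p q e where E: "exponential C Y X E P p q e" using ex_exponential[of Y X] by auto
    \<comment> \<open>\<open>X\<close> serves as the product of \<open>one\<close> and
      \<open>X\<close>, so \<open>f\<close> and \<open>g\<close> transpose to points
      \<open>h\<close> and \<open>h'\<close> of \<open>E\<close>, their names.\<close>
    have Q: "product C one X X (bang X) (Id C X)" by (rule product_one) simp
    obtain h k where h: "h \<in> hom C one E" "k \<in> hom C X P" "p \<cdot> k = h \<cdot> bang X" "q \<cdot> k = Id C X" "e \<cdot> k = f"
      using transpose_ex[OF E Q f] .
    obtain h' k' where h': "h' \<in> hom C one E" "k' \<in> hom C X P" "p \<cdot> k' = h' \<cdot> bang X"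
      "q \<cdot> k' = Id C X" "e \<cdot> k' = g" using transpose_ex[OF E Q g] .
    obtain d D where d: "d \<in> hom C D one" "monic C d"
      "\<And>Z z. z \<in> hom C Z one \<Longrightarrow> sub_le C z d \<longleftrightarrow> h \<cdot> z = h' \<cdot> z"
      by (rule equalizer[OF h(1) h'(1)]) (rule that; blast)
    obtain u where u: "u \<in> hom C one D" using point_if_not_initial[OF ns homE(4)[OF d(1)] no_init] .
    have "d \<cdot> u = Id C one" using bang_eq[OF Comp_hom[OF u d(1)]] by simp
    then have "sub_le C (Id C one) d" using sub_leI[OF d(1) u] by blast
    then have "h = h'" using d(3)[OF Id_hom] homE[OF h(1)] homE[OF h'(1)] by simp
    then have "k = k'" using product_eqI[OF exponentialD(1)[OF E] h(2) h'(2)] h h' by simp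
    then show ?thesis using h(5) h'(5) by simp
  qed
  obtain x where x: "x \<in> hom C one X" using point_if_not_initial[OF ns homE(4)[OF f] no_init] .
  show ?thesis by (rule isomorphism_if_thin[OF thin f Comp_hom[OF bang_hom[OF homE(5)[OF f]] x]])
qed

end

section \<open>Points and decidable objects\<close>

text \<open>\<open>ex_initial\<close> and \<open>nondegenerate\<close> are derived in the final
  theorem from the failure of \<open>quality_type\<close>.\<close>

locale pointed_topos = topos +
  assumes ns: "NS C"
    and ex_initial: "\<exists>Z. initial C Z"
    and nondegenerate: "\<not> initial C one"
begin

section \<open>Consequences of NS for points\<close>

lemma initialI:
  assumes "X \<in> Ob C" "\<And>x. x \<in> hom C one X \<Longrightarrow> False"
  shows "initial C X"
  using point_if_not_initial[OF ns assms(1)] assms(2) by blast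

lemma initial_no_point: "initial C X \<Longrightarrow> x \<notin> hom C one X"
  using strict_initial nondegenerate by blast

text \<open>A point of the domain of a common element would equate \<open>x\<close> and
  \<open>y\<close>; a domain without points is initial by NS.\<close>

lemma disjoint_points_iff:
  assumes x: "x \<in> hom C one X" and y: "y \<in> hom C one X"
  shows "disjoint x y \<longleftrightarrow> x \<noteq> y"
proof
  assume "disjoint x y"
  then show "x \<noteq> y" using disjointD[OF _ x, of x x] sub_le_refl[OF x] nondegenerate by blast
next
  assume neq: "x \<noteq> y"
  show "disjoint x y"
    unfolding disjoint_def
  proof (intro allI impI)
    fix v assume le: "sub_le C v x" "sub_le C v y"
    then obtain a where "a \<in> hom C (Dom C v) one" "x \<cdot> a = v"
      unfolding sub_le_def using homE[OF x] by auto
    then have "v \<in> hom C (Dom C v) X" using Comp_hom[OF _ x] by blast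
    then obtain V where V: "Dom C v = V" and v: "v \<in> hom C V X" by blast
    note [simp] = homE[OF v] homE[OF x] homE[OF y]
    have eq: "v = x \<cdot> bang V" "v = y \<cdot> bang V"
      using iffD1[OF sub_le_point_iff[OF x v] le(1)] iffD1[OF sub_le_point_iff[OF y v] le(2)] .
    show "initial C (Dom C v)"
      unfolding V
    proof (rule initialI)
      fix u assume u: "u \<in> hom C one V"
      have "x = (x \<cdot> bang V) \<cdot> u" "y = (y \<cdot> bang V) \<cdot> u" using homE[OF u] by auto
      then show False using eq neq by metis
    qed simp
  qed
qed

section \<open>Complements in decidable objects\<close>

lemma complementaryD:
  assumes "complementary U V B m n"
  shows "m \<in> hom C U B" "monic C m" "n \<in> hom C V B" "monic C n" "disjoint m n" "covers B m n"
  using assms unfolding complementary_def by auto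

text \<open>Passes from the order of subobjects to generalized elements. The intersection
  \<open>k\<close> lies below the monic \<open>z\<close> from an initial object, so every common
  element has an initial domain by strictness. Comparing the join with the identity gives the
  cover.\<close>

lemma complemented_imp_complementary:
  assumes "complemented C B m"
  obtains V n where "complementary (Dom C m) V B m n"
proof -
  obtain n where mon: "monic C m" "monic C n" and cod: "Cod C m = B" "Cod C n = B"
    and meet: "\<And>w v. w \<in> subobj C B \<Longrightarrow> sub_le C w m \<Longrightarrow> sub_le C w n \<Longrightarrow> v \<in> subobj C B \<Longrightarrow> sub_le C w v"
    and join: "\<And>w v. w \<in> subobj C B \<Longrightarrow> sub_le C m w \<Longrightarrow> sub_le C n w \<Longrightarrow> v \<in> subobj C B \<Longrightarrow> sub_le C v w"
    using assms unfolding complemented_def subobj_def by blast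
  have m: "m \<in> hom C (Dom C m) B" and n: "n \<in> hom C (Dom C n) B"
    using mon cod unfolding monic_def hom_def by auto
  note [simp] = homE[OF m] homE[OF n]
  obtain k K where k: "k \<in> hom C K B" "monic C k"
    "\<And>W w. w \<in> hom C W B \<Longrightarrow> sub_le C w k \<longleftrightarrow> sub_le C w m \<and> sub_le C w n"
    by (rule intersection[OF mon(1) m mon(2) n]) (rule that; blast)
  obtain Z z where Z: "initial C Z" "z \<in> hom C Z B" using ex_initial initial_ex homE(5)[OF m] by blast
  have "monic C z"
    by (rule monicI[OF Z(2)]) (use initial_eq strict_initial[OF Z(1)] in blast)
  then have "sub_le C k z"
    using meet[of k z] k sub_le_refl[OF k(1)] homE[OF k(1)] homE[OF Z(2)] by (simp add: subobj_def)
  then obtain l where l: "l \<in> hom C K Z" using sub_leE[OF _ k(1) Z(2)] by blast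
  have "disjoint m n"
    unfolding disjoint_def
  proof (intro allI impI)
    fix v assume le: "sub_le C v m" "sub_le C v n"
    then obtain a where "a \<in> hom C (Dom C v) (Dom C m)" "m \<cdot> a = v" unfolding sub_le_def by blast
    then have v: "v \<in> hom C (Dom C v) B" using Comp_hom[OF _ m] by blast
    then obtain b where "b \<in> hom C (Dom C v) K" using k(3)[OF v] le sub_leE[OF _ v k(1)] by blast
    then show "initial C (Dom C v)" using strict_initial[OF Z(1) Comp_hom[OF _ l]] by blast
  qed
  moreover have "covers B m n"
    unfolding covers_def
  proof (intro allI impI)
    fix W w assume w: "w \<in> hom C W B" "monic C w" "sub_le C m w" "sub_le C n w"
    have "monic C (Id C B)" by (rule split_monic[OF Id_hom Id_hom]) simp_all
    then show "sub_le C (Id C B) w" using join[of w "Id C B"] w homE[OF w(1)] by (simp add: subobj_def)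
  qed
  ultimately have "complementary (Dom C m) (Dom C n) B m n"
    using m n mon unfolding complementary_def by blast
  then show thesis using that by blast
qed

lemma decidable_diagonal_complement:
  assumes D: "decidable C D" and P: "product C D D P p q"
  obtains d V n where "d \<in> hom C D P" "p \<cdot> d = Id C D" "q \<cdot> d = Id C D" "complementary D V P d n"
proof -
  have "D \<in> Ob C" using D unfolding decidable_def by blast
  then obtain d where d: "d \<in> hom C D P" "p \<cdot> d = Id C D" "q \<cdot> d = Id C D"
    using product_pair[OF P Id_hom Id_hom] by blast
  then have "complemented C P d" using D P unfolding decidable_def by blast
  then show thesis using complemented_imp_complementary that d homE[OF d(1)] by metis
qed

text \<open>Along \<open>j\<close>, which pairs an element with \<open>x\<close>, the diagonal pulls
  back to the point \<open>x\<close>, and the complement of the diagonal to a complement of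
  \<open>x\<close>.\<close>

lemma decidable_point_complement:
  assumes D: "decidable C D" and x: "x \<in> hom C one D"
  obtains V n where "complementary one V D x n"
proof -
  note [simp] = homE[OF x]
  obtain P p q where P: "product C D D P p q" using product_exists[of D D] by auto
  obtain d N \<nu> where d: "d \<in> hom C D P" "p \<cdot> d = Id C D" "q \<cdot> d = Id C D"
    and \<nu>: "complementary D N P d \<nu>"
    using decidable_diagonal_complement[OF D P] .
  obtain j where j: "j \<in> hom C D P" "p \<cdot> j = Id C D" "q \<cdot> j = x \<cdot> bang D"
    using product_pair[OF P Id_hom Comp_hom[OF bang_hom x]] by auto
  note [simp] = homE[OF productD(1)[OF P]] homE[OF productD(2)[OF P]] homE[OF j(1)]
  have diag: "sub_le C (j \<cdot> v) d \<longleftrightarrow> sub_le C v x" if v: "v \<in> hom C V D" for V v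
    using diagonal_le_iff[OF P d Comp_hom[OF v j(1)]] sub_le_point_iff[OF x v] homE[OF v]
      comp_reassoc[OF j(2), of v] comp_reassoc[OF j(3), of v] by simp
  obtain n V where n: "n \<in> hom C V D" "monic C n"
    "\<And>W w. w \<in> hom C W D \<Longrightarrow> sub_le C w n \<longleftrightarrow> sub_le C (j \<cdot> w) \<nu>"
    by (rule inverse_image[OF j(1) complementaryD(4,3)[OF \<nu>]]) (rule that; blast)
  have "disjoint x n"
    unfolding disjoint_def
  proof (intro allI impI)
    fix v assume le: "sub_le C v x" "sub_le C v n"
    then obtain a where "a \<in> hom C (Dom C v) one" "x \<cdot> a = v" unfolding sub_le_def by auto
    then have v: "v \<in> hom C (Dom C v) D" using Comp_hom[OF _ x] by blast
    show "initial C (Dom C v)"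
      using disjointD[OF complementaryD(5)[OF \<nu>] Comp_hom[OF v j(1)]] diag[OF v] n(3)[OF v] le by blast
  qed
  moreover have "covers D x n"
    unfolding covers_def
  proof (intro allI impI)
    fix W w assume w: "w \<in> hom C W D" "monic C w" and le: "sub_le C x w" "sub_le C n w"
    show "sub_le C (Id C D) w"
    proof (rule covers_pullback[OF complementaryD(6,1,3)[OF \<nu>] j(1) w])
      fix Z z assume z: "z \<in> hom C Z D" "sub_le C (j \<cdot> z) d \<or> sub_le C (j \<cdot> z) \<nu>"
      then have "sub_le C z x \<or> sub_le C z n" using diag[OF z(1)] n(3)[OF z(1)] by blast
      then show "sub_le C z w"
        using sub_le_trans[OF _ le(1) z(1) x w(1)] sub_le_trans[OF _ le(2) z(1) n(1) w(1)] by blast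
    qed
  qed
  ultimately have "complementary one V D x n"
    using x point_monic[OF x] n(1,2) unfolding complementary_def by blast
  then show thesis using that by blast
qed

text \<open>As \<open>n\<close> is the complement of \<open>x\<close>, the implication
  \<open>s\<close> from \<open>n\<close> to \<open>y\<close> describes the elements that equal
  \<open>y\<close> unless they equal \<open>x\<close>, that is, the part consisting of
  \<open>x\<close> and \<open>y\<close>.\<close>

lemma decidable_two_points:
  assumes D: "decidable C D" and x: "x \<in> hom C one D" and y: "y \<in> hom C one D" and neq: "x \<noteq> y"
  obtains S i j where "complementary one one S i j"
proof -
  note [simp] = homE[OF x] homE[OF y]
  obtain V n where n: "complementary one V D x n" using decidable_point_complement[OF D x] .
  note nD = complementaryD[OF n]
  obtain s S where s: "s \<in> hom C S D" "monic C s"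
    "\<And>W w. w \<in> hom C W D \<Longrightarrow> sub_le C w s \<longleftrightarrow>
      (\<forall>Z z. z \<in> hom C Z W \<longrightarrow> sub_le C (w \<cdot> z) n \<longrightarrow> sub_le C (w \<cdot> z) y)"
    by (rule implication[OF nD(4,3) point_monic[OF y] y]) (rule that; blast)
  note [simp] = homE[OF s(1)]
  \<comment> \<open>At \<open>x\<close> the implication is vacuous, since \<open>x\<close> and
    \<open>n\<close> are disjoint.\<close>
  have "sub_le C (x \<cdot> z) y" if z: "z \<in> hom C Z one" and le: "sub_le C (x \<cdot> z) n" for Z z
  proof -
    have "sub_le C (x \<cdot> z) x" using sub_leI[OF x z] by blast
    then have "initial C Z" using disjointD[OF nD(5) Comp_hom[OF z x]] le by blast
    then show ?thesis using initial_sub_le[OF _ Comp_hom[OF z x] y] by blast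
  qed
  then have "sub_le C x s" using s(3)[OF x] by blast
  then obtain i where i: "i \<in> hom C one S" "s \<cdot> i = x" using sub_leE[OF _ x s(1)] by blast
  have "sub_le C y s" using s(3)[OF y] sub_leI[OF y] by blast
  then obtain j where j: "j \<in> hom C one S" "s \<cdot> j = y" using sub_leE[OF _ y s(1)] by blast
  have "disjoint i j" using disjoint_points_iff[OF i(1) j(1)] i j neq by blast
  moreover have "covers S i j"
    unfolding covers_def
  proof (intro allI impI)
    fix W w assume w: "w \<in> hom C W S" "monic C w" and le: "sub_le C i w" "sub_le C j w"
    show "sub_le C (Id C S) w"
    proof (rule covers_pullback[OF nD(6,1,3) s(1) w])
      fix Z z assume z: "z \<in> hom C Z S" and or: "sub_le C (s \<cdot> z) x \<or> sub_le C (s \<cdot> z) n"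
      note [simp] = homE[OF z]
      have sz: "s \<cdot> z \<in> hom C Z D" using Comp_hom[OF z s(1)] .
      have "sub_le C (s \<cdot> z) s" using sub_leI[OF s(1) z] by blast
      then have "sub_le C ((s \<cdot> z) \<cdot> Id C Z) n \<longrightarrow> sub_le C ((s \<cdot> z) \<cdot> Id C Z) y"
        using s(3)[OF sz] Id_hom[OF homE(4)[OF z]] by blast
      then have "sub_le C (s \<cdot> z) (s \<cdot> i) \<or> sub_le C (s \<cdot> z) (s \<cdot> j)" using or i j by auto
      then have "sub_le C z i \<or> sub_le C z j"
        using sub_le_monic_cancel[OF _ s(2,1) z i(1)] sub_le_monic_cancel[OF _ s(2,1) z j(1)] by blast
      then show "sub_le C z w"
        using sub_le_trans[OF _ le(1) z i(1) w(1)] sub_le_trans[OF _ le(2) z j(1) w(1)] by blast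
    qed
  qed
  ultimately have "complementary one one S i j"
    using i(1) j(1) point_monic unfolding complementary_def by blast
  then show thesis using that by blast
qed

text \<open>The points classify the least and the greatest subobject of \<open>one\<close>; if they
  were equal, an initial object would have a point.\<close>

lemma omega_two_points:
  obtains x y where "x \<in> hom C one omega" "y \<in> hom C one omega" "x \<noteq> y"
proof -
  obtain Z z where Z: "initial C Z" "z \<in> hom C Z one" using ex_initial initial_ex one_Ob by blast
  have "monic C z" by (rule monicI[OF Z(2)]) (use initial_eq strict_initial[OF Z(1)] in blast)
  then obtain \<chi> where \<chi>: "\<chi> \<in> hom C one omega"
    "\<And>V v. v \<in> hom C V one \<Longrightarrow> \<chi> \<cdot> v = tr V \<longleftrightarrow> sub_le C v z"
    by (rule classify[OF _ Z(2)]) (rule that; blast)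
  have "\<chi> \<noteq> tr one"
  proof
    assume "\<chi> = tr one"
    then have "sub_le C (Id C one) z" using \<chi>(2)[OF Id_hom] homE[OF \<chi>(1)] by simp
    then obtain u where "u \<in> hom C one Z" using sub_leE[OF _ Id_hom Z(2)] by auto
    then show False using initial_no_point[OF Z(1)] by blast
  qed
  then show thesis using that \<chi>(1) tr_hom[OF one_Ob] by blast
qed

section \<open>Minimal decidable objects and their points\<close>

lemma minimal_decidable_factor:
  assumes "minimal_decidable C X P p" "complementary one one S i j" "f \<in> hom C X S"
  shows "\<exists>!g. g \<in> hom C P S \<and> g \<cdot> p = f"
  using assms complementary_coproduct terminal_one unfolding minimal_decidable_def by blast

lemma minimal_decidableD:
  assumes "minimal_decidable C X P p"
  shows "decidable C P" "p \<in> hom C X P"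
  using assms unfolding minimal_decidable_def by auto

lemma minimal_decidable_eqI:
  assumes min: "minimal_decidable C X P p" and S: "complementary one one S i j"
    and g: "g \<in> hom C P S" "g' \<in> hom C P S" and eq: "g \<cdot> p = g' \<cdot> p"
  shows "g = g'"
proof -
  have "\<exists>!k. k \<in> hom C P S \<and> k \<cdot> p = g' \<cdot> p"
    using minimal_decidable_factor[OF min S Comp_hom[OF minimal_decidableD(2)[OF min] g(2)]] .
  then show ?thesis by (rule ex1E) (use g eq in metis)
qed

text \<open>If nothing lies over \<open>y\<close>, then the map \<open>c\<close> separating
  \<open>y\<close> from its complement agrees with the constant \<open>j\<close> after
  \<open>p\<close>: the part of \<open>X\<close> over \<open>y\<close> has no points, hence is
  initial, and elsewhere \<open>c\<close> is \<open>j\<close>. Unique factorization makes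
  \<open>c\<close> constant, against \<open>c \<cdot> y = i\<close>.\<close>

lemma minimal_decidable_point_lift:
  assumes min: "minimal_decidable C X P p" and S: "complementary one one S i j"
    and y: "y \<in> hom C one P"
  shows "\<exists>x \<in> hom C one X. p \<cdot> x = y"
proof (rule ccontr)
  assume "\<not> ?thesis"
  then have no_lift: "p \<cdot> x \<noteq> y" if "x \<in> hom C one X" for x using that by blast
  note p = minimal_decidableD(2)[OF min]
  obtain V n where n: "complementary one V P y n"
    using decidable_point_complement[OF minimal_decidableD(1)[OF min] y] .
  note nD = complementaryD[OF n] and i = complementaryD(1)[OF S] and j = complementaryD(3)[OF S]
  note [simp] = homE[OF p] homE[OF y] homE[OF nD(3)] homE[OF i] homE[OF j]
  have jV: "j \<cdot> bang V \<in> hom C V S" and c': "j \<cdot> bang P \<in> hom C P S" by (auto simp: hom_def)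
  then obtain c where c: "c \<in> hom C P S" "c \<cdot> y = i" "c \<cdot> n = j \<cdot> bang V"
    using complementary_coproduct[OF n] i homE(5)[OF i] unfolding coproduct_def by blast
  note [simp] = homE[OF c(1)]
  have cp: "c \<cdot> p \<in> hom C X S" and c'p: "j \<cdot> bang X \<in> hom C X S" by (auto simp: hom_def)
  obtain d D where d: "d \<in> hom C D X" "monic C d"
    "\<And>Z z. z \<in> hom C Z X \<Longrightarrow> sub_le C z d \<longleftrightarrow> (c \<cdot> p) \<cdot> z = (j \<cdot> bang X) \<cdot> z"
    by (rule equalizer[OF cp c'p]) (rule that; blast)
  have "sub_le C (Id C X) d"
  proof (rule covers_pullback[OF nD(6,1,3) p d(1,2)])
    fix Z z assume z: "z \<in> hom C Z X" and or: "sub_le C (p \<cdot> z) y \<or> sub_le C (p \<cdot> z) n"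
    note [simp] = homE[OF z]
    have pz: "p \<cdot> z \<in> hom C Z P" using Comp_hom[OF z p] .
    from or show "sub_le C z d"
    proof
      assume "sub_le C (p \<cdot> z) y"
      then have eq: "p \<cdot> z = y \<cdot> bang Z" using sub_le_point_iff[OF y pz] by blast
      have "initial C Z"
      proof (rule initialI)
        fix u assume u: "u \<in> hom C one Z"
        note [simp] = homE[OF u]
        have "p \<cdot> z \<cdot> u = y" using comp_reassoc[OF eq, of u] by simp
        then show False using no_lift[OF Comp_hom[OF u z]] by blast
      qed simp
      then show ?thesis using initial_sub_le[OF _ z d(1)] by blast
    next
      assume "sub_le C (p \<cdot> z) n"
      then obtain u where u: "u \<in> hom C Z V" "n \<cdot> u = p \<cdot> z" using sub_leE[OF _ pz nD(3)] by blast
      note [simp] = homE[OF u(1)]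
      have "c \<cdot> p \<cdot> z = j \<cdot> bang Z" using comp_reassoc[OF c(3), of u] u(2) by simp
      then show ?thesis using d(3)[OF z] by simp
    qed
  qed
  then have "c \<cdot> p = (j \<cdot> bang P) \<cdot> p" using d(3)[OF Id_hom] by simp
  then have "c = j \<cdot> bang P" using minimal_decidable_eqI[OF min S c(1) c'] by blast
  then have "i = j" using c(2) by simp
  then show False using disjoint_points_iff[OF i j] complementaryD(5)[OF S] by blast
qed

text \<open>Some \<open>h\<close> sends \<open>x\<close> to \<open>a\<close> and \<open>y\<close> to
  \<open>b\<close>; the composite \<open>f \<cdot> h\<close> factors through \<open>p\<close>, which
  does not distinguish \<open>x\<close> from \<open>y\<close>.\<close>

lemma disjoint_injective_points_identified:
  assumes min: "minimal_decidable C X P p" and x: "x \<in> hom C one X" and y: "y \<in> hom C one X"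
    and neq: "x \<noteq> y" and eq: "p \<cdot> x = p \<cdot> y"
    and S: "complementary one one S i j" and E: "disjoint_injective E" and f: "f \<in> hom C E S"
    and a: "a \<in> hom C one E" and b: "b \<in> hom C one E"
  shows "f \<cdot> a = f \<cdot> b"
proof -
  obtain h where h: "h \<in> hom C X E" "h \<cdot> x = a" "h \<cdot> y = b"
    using disjoint_injectiveE[OF E x point_monic[OF x] y point_monic[OF y] _ a b]
      disjoint_points_iff[OF x y] neq by blast
  obtain g where g: "g \<in> hom C P S" "g \<cdot> p = f \<cdot> h"
    using minimal_decidable_factor[OF min S Comp_hom[OF h(1) f]] by blast
  note [simp] = homE[OF x] homE[OF y] homE[OF h(1)] homE[OF f] homE[OF g(1)]
    homE[OF minimal_decidableD(2)[OF min]]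
  have "f \<cdot> h \<cdot> x = g \<cdot> p \<cdot> x" "f \<cdot> h \<cdot> y = g \<cdot> p \<cdot> y"
    using comp_reassoc[OF g(2), of x] comp_reassoc[OF g(2), of y] by simp_all
  then show ?thesis using h(2,3) eq by simp
qed

text \<open>If \<open>E\<close> were initial, \<open>z\<close> would be monic and disjoint from
  itself, and extending the identity of \<open>E\<close> along it would give \<open>E\<close> a
  point.\<close>

lemma disjoint_injective_point:
  assumes "disjoint_injective E"
  obtains a where "a \<in> hom C one E"
proof (rule point_if_not_initial[OF ns])
  show E: "E \<in> Ob C" using assms unfolding disjoint_injective_def by blast
  show "\<not> initial C E"
  proof
    assume init: "initial C E"
    obtain z where z: "z \<in> hom C E one" using bang_hom[OF E] by blast
    have mon: "monic C z" by (rule monicI[OF z]) (use initial_eq strict_initial[OF init] in blast)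
    have "disjoint z z"
      unfolding disjoint_def sub_le_def using strict_initial[OF init] homE[OF z] by auto
    then obtain h where "h \<in> hom C one E"
      using disjoint_injectiveE[OF assms z mon z mon _ Id_hom[OF E] Id_hom[OF E]] by blast
    then show False using initial_no_point[OF init] by blast
  qed
qed (use that in blast)

text \<open>A point of the complement \<open>V\<close> of \<open>d\<close> would lift to a point
  \<open>b\<close> of \<open>E\<close>, and \<open>c \<cdot> p\<close> would separate
  \<open>a\<close> from \<open>b\<close>. So \<open>V\<close> is initial and \<open>d\<close> alone
  covers \<open>P\<close>.\<close>

lemma disjoint_injective_terminal_minimal_decidable:
  assumes minX: "minimal_decidable C X Q q" and x: "x \<in> hom C one X" and y: "y \<in> hom C one X"
    and neq: "x \<noteq> y" and eq: "q \<cdot> x = q \<cdot> y"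
    and S: "complementary one one S i j"
    and E: "disjoint_injective E" and min: "minimal_decidable C E P p"
  shows "terminal C P"
proof -
  obtain a where a: "a \<in> hom C one E" using disjoint_injective_point[OF E] .
  note p = minimal_decidableD(2)[OF min]
  define d where "d = p \<cdot> a"
  have d: "d \<in> hom C one P" using Comp_hom[OF a p] unfolding d_def .
  obtain V n where n: "complementary one V P d n"
    using decidable_point_complement[OF minimal_decidableD(1)[OF min] d] .
  note nD = complementaryD[OF n] and i = complementaryD(1)[OF S] and j = complementaryD(3)[OF S]
  note [simp] = homE[OF p] homE[OF d] homE[OF nD(3)] homE[OF i] homE[OF j] homE[OF a]
  have "j \<cdot> bang V \<in> hom C V S" by (auto simp: hom_def)
  then obtain c where c: "c \<in> hom C P S" "c \<cdot> d = i" "c \<cdot> n = j \<cdot> bang V"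
    using complementary_coproduct[OF n] i homE(5)[OF i] unfolding coproduct_def by blast
  note [simp] = homE[OF c(1)]
  have "initial C V"
  proof (rule initialI)
    fix v assume v: "v \<in> hom C one V"
    note [simp] = homE[OF v]
    obtain b where b: "b \<in> hom C one E" "p \<cdot> b = n \<cdot> v"
      using minimal_decidable_point_lift[OF min S Comp_hom[OF v nD(3)]] by blast
    note [simp] = homE[OF b(1)]
    have "(c \<cdot> p) \<cdot> a = (c \<cdot> p) \<cdot> b"
      using disjoint_injective_points_identified[OF minX x y neq eq S E Comp_hom[OF p c(1)] a b(1)] .
    moreover have "(c \<cdot> p) \<cdot> b = j" using comp_reassoc[OF c(3), of v] b(2) by simp
    ultimately have "i = j" using c(2) d_def by simp
    then show False using disjoint_points_iff[OF i j] complementaryD(5)[OF S] by blast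
  qed simp
  then have "sub_le C n d" using initial_sub_le[OF _ nD(3) d] by blast
  then have "sub_le C (Id C P) d"
    using coversD[OF nD(6) d point_monic[OF d]] sub_le_refl[OF d] by blast
  then have eqd: "z = d \<cdot> bang Z" if "z \<in> hom C Z P" for Z z
    using sub_le_if_Id[OF _ d that] sub_le_point_iff[OF d that] by blast
  show ?thesis
    unfolding terminal_def
  proof (intro conjI ballI)
    fix Z assume "Z \<in> Ob C"
    then show "\<exists>!z. z \<in> hom C Z P" using Comp_hom[OF bang_hom d] eqd by blast
  qed simp
qed

text \<open>The pair \<open>j\<close> of \<open>f\<close> and \<open>g\<close> pulls the
  decomposition of \<open>Q\<close> into diagonal and complement back to \<open>Z\<close>. A point
  in the part over the complement would violate injectivity on points, so that part is initial by
  NS.\<close>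

lemma decidable_monic_if_injective_on_points:
  assumes G: "decidable C G" and t: "t \<in> hom C G P"
    and inj: "\<And>a b. a \<in> hom C one G \<Longrightarrow> b \<in> hom C one G \<Longrightarrow> t \<cdot> a = t \<cdot> b \<Longrightarrow> a = b"
  shows "monic C t"
proof (rule monicI[OF t])
  fix Z f g assume f: "f \<in> hom C Z G" and g: "g \<in> hom C Z G" and eq: "t \<cdot> f = t \<cdot> g"
  note [simp] = homE[OF f] homE[OF g] homE[OF t]
  obtain Q r s where Q: "product C G G Q r s" using product_exists[of G G] by auto
  obtain d V n where d: "d \<in> hom C G Q" "r \<cdot> d = Id C G" "s \<cdot> d = Id C G"
    and n: "complementary G V Q d n" using decidable_diagonal_complement[OF G Q] .
  obtain j where j: "j \<in> hom C Z Q" "r \<cdot> j = f" "s \<cdot> j = g" using product_pair[OF Q f g] .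
  note [simp] = homE[OF productD(1)[OF Q]] homE[OF productD(2)[OF Q]] homE[OF j(1)]
  note nD = complementaryD[OF n]
  obtain e E where e: "e \<in> hom C E Z" "monic C e"
    "\<And>Y y. y \<in> hom C Y Z \<Longrightarrow> sub_le C y e \<longleftrightarrow> f \<cdot> y = g \<cdot> y"
    by (rule equalizer[OF f g]) (rule that; blast)
  have diag: "sub_le C (j \<cdot> y) d \<longleftrightarrow> f \<cdot> y = g \<cdot> y" if y: "y \<in> hom C Y Z" for Y y
    using diagonal_le_iff[OF Q d Comp_hom[OF y j(1)]] homE[OF y]
      comp_reassoc[OF j(2), of y] comp_reassoc[OF j(3), of y] by simp
  have "sub_le C (Id C Z) e"
  proof (rule covers_pullback[OF nD(6,1,3) j(1) e(1,2)])
    fix Y y assume y: "y \<in> hom C Y Z" and or: "sub_le C (j \<cdot> y) d \<or> sub_le C (j \<cdot> y) n"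
    note [simp] = homE[OF y]
    have jy: "j \<cdot> y \<in> hom C Y Q" using Comp_hom[OF y j(1)] .
    from or show "sub_le C y e"
    proof
      assume "sub_le C (j \<cdot> y) d"
      then show ?thesis using diag[OF y] e(3)[OF y] by blast
    next
      assume le: "sub_le C (j \<cdot> y) n"
      have "initial C Y"
      proof (rule initialI)
        fix u assume u: "u \<in> hom C one Y"
        note [simp] = homE[OF u]
        have yu: "y \<cdot> u \<in> hom C one Z" using Comp_hom[OF u y] .
        have "t \<cdot> f \<cdot> y \<cdot> u = t \<cdot> g \<cdot> y \<cdot> u"
          using comp_reassoc[OF eq, of "y \<cdot> u"] by simp
        then have "f \<cdot> y \<cdot> u = g \<cdot> y \<cdot> u" using inj Comp_hom[OF yu f] Comp_hom[OF yu g] by blast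
        then have "sub_le C (j \<cdot> y \<cdot> u) d" using diag[OF yu] by blast
        moreover have "sub_le C (j \<cdot> y \<cdot> u) n" using sub_le_comp[OF le jy nD(3) u] by simp
        ultimately show False
          using disjointD[OF nD(5) Comp_hom[OF yu j(1)]] nondegenerate by blast
      qed simp
      then show ?thesis using initial_sub_le[OF _ y e(1)] by blast
    qed
  qed
  then show "f = g" using e(3)[OF Id_hom] by simp
qed

text \<open>\<open>p \<cdot> g\<close> is a decidable subobject of \<open>P\<close> containing all
  points, because these lift along \<open>p\<close> to \<open>X\<close> and then to
  \<open>G\<close>. So is the identity of \<open>P\<close>; uniqueness in DSO gives the monic
  \<open>p \<cdot> g\<close> a section, hence an inverse.\<close>

lemma theta_isomorphism:
  assumes dso: "DSO C" and min: "minimal_decidable C X P p" and dps: "decidable_points_subobj C X G g"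
    and S: "complementary one one S i j"
    and inj: "\<And>x y. x \<in> hom C one X \<Longrightarrow> y \<in> hom C one X \<Longrightarrow> p \<cdot> x = p \<cdot> y \<Longrightarrow> x = y"
  shows "isomorphism C (p \<cdot> g)"
proof -
  note p = minimal_decidableD(2)[OF min]
  have g: "g \<in> hom C G X" "monic C g" and G: "decidable C G"
    and pts: "\<And>x. x \<in> points C X \<Longrightarrow> \<exists>y \<in> hom C (Dom C x) G. g \<cdot> y = x"
    using dps unfolding decidable_points_subobj_def subobj_def monic_def hom_def by auto
  note [simp] = homE[OF p] homE[OF g(1)]
  have t: "p \<cdot> g \<in> hom C G P" using Comp_hom[OF g(1) p] .
  have mon: "monic C (p \<cdot> g)"
  proof (rule decidable_monic_if_injective_on_points[OF G t])
    fix a b assume a: "a \<in> hom C one G" and b: "b \<in> hom C one G" and eq: "(p \<cdot> g) \<cdot> a = (p \<cdot> g) \<cdot> b"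
    have "p \<cdot> g \<cdot> a = p \<cdot> g \<cdot> b" using eq homE[OF a] homE[OF b] by simp
    then have "g \<cdot> a = g \<cdot> b" using inj Comp_hom[OF a g(1)] Comp_hom[OF b g(1)] by blast
    then show "a = b" using monicD[OF g(2,1) _ a b] by blast
  qed
  have "\<exists>z \<in> hom C (Dom C y) G. (p \<cdot> g) \<cdot> z = y" if "y \<in> points C P" for y
  proof -
    obtain T where T: "terminal C T" and y: "y \<in> hom C T P" using \<open>y \<in> points C P\<close> unfolding points_def by blast
    note [simp] = homE[OF y]
    \<comment> \<open>Members of \<open>points\<close> may start at any terminal object, so
      \<open>y\<close> is moved to \<open>one\<close> along \<open>u\<close> and later back along
      \<open>bang T\<close>.\<close>
    obtain u where u: "u \<in> hom C one T" using terminal_ex[OF T one_Ob] by blast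
    obtain x where x: "x \<in> hom C one X" "p \<cdot> x = y \<cdot> u"
      using minimal_decidable_point_lift[OF min S Comp_hom[OF u y]] by blast
    note [simp] = homE[OF x(1)] homE[OF u]
    have "x \<in> points C X" using x(1) terminal_one unfolding points_def by blast
    then obtain z where z: "z \<in> hom C one G" "g \<cdot> z = x" using pts[of x] by auto
    note [simp] = homE[OF z(1)]
    have "u \<cdot> bang T = Id C T"
      using terminal_eq[OF T Comp_hom[OF bang_hom u] Id_hom] by simp
    then have "(p \<cdot> g) \<cdot> z \<cdot> bang T = y"
      using comp_reassoc[OF z(2), of "bang T"] comp_reassoc[OF x(2), of "bang T"] by simp
    then show ?thesis using Comp_hom[OF bang_hom z(1), of T] by force
  qed
  then have "decidable_points_subobj C P G (p \<cdot> g)"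
    using mon G unfolding decidable_points_subobj_def subobj_def by simp
  moreover have "monic C (Id C P)" by (rule split_monic[OF Id_hom Id_hom]) simp_all
  then have "decidable_points_subobj C P P (Id C P)"
    using minimal_decidableD(1)[OF min]
    unfolding decidable_points_subobj_def subobj_def points_def hom_def by auto
  ultimately have "sub_le C (Id C P) (p \<cdot> g)" using dso homE(5)[OF p] unfolding DSO_def by blast
  then obtain h where h: "h \<in> hom C P G" "(p \<cdot> g) \<cdot> h = Id C P" using sub_leE[OF _ Id_hom t] by auto
  note [simp] = homE[OF h(1)]
  have "h \<cdot> p \<cdot> g = Id C G"
    by (rule monicD[OF mon t _ Comp_hom[OF t h(1)] Id_hom])
      (use comp_reassoc[OF h(2), of "p \<cdot> g"] in simp_all)
  then show ?thesis using h unfolding isomorphism_def by auto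
qed

end

section \<open>Sufficient cohesion\<close>

theorem theorem8p2:
  fixes C :: "('o, 'm) cat"
    and \<Pi> \<Gamma> :: "'o \<Rightarrow> 'o"
    and p \<gamma> :: "'o \<Rightarrow> 'm"
  assumes "topos C"
    and "NS C"
    and "WDQO C"
    and "DSO C"
    and "Pi_choice C \<Pi> p"
    and "Gamma_choice C \<Gamma> \<gamma>"
    and "\<not> quality_type C p \<gamma>"
  shows "sufficiently_cohesive C \<Pi>"
proof -
  interpret topos C by fact
  have min: "minimal_decidable C X (\<Pi> X) (p X)" if "X \<in> Ob C" for X
    using assms(5) that unfolding Pi_choice_def by blast
  have dps: "decidable_points_subobj C X (\<Gamma> X) (\<gamma> X)" if "X \<in> Ob C" for X
    using assms(6) that unfolding Gamma_choice_def by blast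
  obtain X where X: "X \<in> Ob C" and not_iso: "\<not> isomorphism C (p X \<cdot>\<^bsub>C\<^esub> \<gamma> X)"
    using assms(7) unfolding quality_type_def by blast
  have "p X \<cdot>\<^bsub>C\<^esub> \<gamma> X \<in> hom C (\<Gamma> X) (\<Pi> X)"
    using min[OF X] dps[OF X]
    unfolding minimal_decidable_def decidable_points_subobj_def subobj_def monic_def hom_def by auto
  \<comment> \<open>Either degenerate case would make the component at \<open>X\<close>
    invertible.\<close>
  then interpret pointed_topos C
    using isomorphism_if_initial_one isomorphism_if_no_initial[OF \<open>NS C\<close>] not_iso \<open>NS C\<close>
    by unfold_locales blast+
  obtain a b where ab: "a \<in> hom C one omega" "b \<in> hom C one omega" "a \<noteq> b" using omega_two_points .
  have dec: "decidable C (\<Gamma> omega)" and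
    pts: "\<And>x. x \<in> points C omega \<Longrightarrow> \<exists>y \<in> hom C (Dom C x) (\<Gamma> omega). \<gamma> omega \<cdot>\<^bsub>C\<^esub> y = x"
    using dps[of omega] unfolding decidable_points_subobj_def by auto
  \<comment> \<open>The two points of \<open>omega\<close> lift to the decidable object
    \<open>\<Gamma> omega\<close>, which is where \<open>1 + 1\<close> can be cut out.\<close>
  have "\<exists>y \<in> hom C one (\<Gamma> omega). \<gamma> omega \<cdot>\<^bsub>C\<^esub> y = x" if "x \<in> hom C one omega" for x
    using pts[of x] that terminal_one homE[OF that] unfolding points_def by auto
  then obtain a' b' where "a' \<in> hom C one (\<Gamma> omega)" "b' \<in> hom C one (\<Gamma> omega)" "a' \<noteq> b'"
    using ab by metis
  then obtain S i j where S: "complementary one one S i j" using decidable_two_points[OF dec] by blast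
  obtain x y where x: "x \<in> hom C one X" and y: "y \<in> hom C one X" and "x \<noteq> y"
    and eq: "p X \<cdot>\<^bsub>C\<^esub> x = p X \<cdot>\<^bsub>C\<^esub> y"
    using theta_isomorphism[OF \<open>DSO C\<close> min[OF X] dps[OF X] S] not_iso by blast
  have connected: "connected C \<Pi> E" if "disjoint_injective E" for E
  proof -
    have "E \<in> Ob C" using that unfolding disjoint_injective_def by blast
    then show ?thesis
      using disjoint_injective_terminal_minimal_decidable[OF min[OF X] x y \<open>x \<noteq> y\<close> eq S that min]
      unfolding connected_def by blast
  qed
  show ?thesis
    unfolding sufficiently_cohesive_def
  proof
    fix Y assume Y: "Y \<in> Ob C"
    obtain A P r s e where A: "exponential C omega Y A P r s e" using ex_exponential[OF omega_Ob Y] by blast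
    \<comment> \<open>Contractibility asks that every power of \<open>A\<close> be connected; such
      powers inherit disjoint-injectivity from \<open>A\<close>.\<close>
    have inj: "disjoint_injective A"
      using exponential_disjoint_injective[OF omega_disjoint_injective A] .
    then have "A \<in> Ob C" unfolding disjoint_injective_def by blast
    then have "Lawvere_contractible C \<Pi> A"
      unfolding Lawvere_contractible_def using connected exponential_disjoint_injective[OF inj] by blast
    moreover obtain \<sigma> where "\<sigma> \<in> hom C Y A" "monic C \<sigma>" using singleton_monic[OF Y A] .
    ultimately show "\<exists>A m. Lawvere_contractible C \<Pi> A \<and> m \<in> hom C Y A \<and> monic C m" by blast
  qed
qed

end
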